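(* Let $V$ be a vertex operator algebra such that $L(0)$ acts semisimply on any weak $V$-module. Then for any (ordinary) $V$-module $W$ we have $D(W)=W'$.
   Context: All vector spaces are over $\mathbb{C}$. A vertex operator algebra $V=\coprod_{n\in\mathbb{Z}}V_{(n)}$ is meant in the standard sense of Frenkel–Huang–Lepowsky: $Y(v,x)=\sum_{n\in\mathbb{Z}}v_nx^{-n-1}$, vacuum $\mathbf{1}$, $Y(\omega,x)=\sum_n L(n)x^{-n-2}$, $V_{(n)}$ is the $L(0)$-eigenspace of eigenvalue $n$, $\dim V_{(n)}<\infty$, $V_{(n)}=0$ for $n$ sufficiently negative. A weak $V$-module is a vector space $W$ with a linear map $v\mapsto Y(v,x)=\sum_n v_nx^{-n-1}\in(\mathrm{End}\,W)[[x,x^{-1}]]$ satisfying $Y(v,x)w\in W((x))$, $Y(\mathbf{1},x)=\mathrm{id}_W$ and the Jacobi identity (no grading required). A (ordinary) $V$-module is a weak $V$-module $W=\coprod_{h\in\mathbb{C}}W_{(h)}$ graded by $L(0)$-eigenspaces with $\dim W_{(h)}<\infty$ and, for each $h\in\mathbb{C}$, $W_{(h+n)}=0$ for all sufficiently negative integers $n$; its restricted dual is $W'=\coprod_{h\in\mathbb{C}}W_{(h)}^*\subseteq W^*$. For $v\in V$ and $\alpha\in W^*$ (full linear dual) define $Y^*(v,x)\alpha=\sum_{n\in\mathbb{Z}}(v^*_n\alpha)x^{-n-1}$ by $$\langle Y^*(v,x)\alpha,w\rangle=\left\langle\alpha,Y\left(e^{xL(1)}(-x^{-2})^{L(0)}v,x^{-1}\right)w\right\rangle,\quad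 w\in W.$$ $D(W)$ is the subspace of all $\alpha\in W^*$ such that $Y^*(v,x)\alpha\in W^*((x))$ for every $v\in V$. *)

theory Defs
  imports Complex_Main "HOL-Library.Groups_Big_Fun" "HOL-Library.Function_Algebras"
begin

text \<open>
  A vertex operator map is encoded by its modes: \<open>Y v n w\<close> is \<open>v\<^sub>n w\<close>,
  where \<open>Y(v,x) = \<Sum>\<^sub>n v\<^sub>n x\<^sup>-\<^sup>n\<^sup>-\<^sup>1\<close> with \<open>n\<close> ranging over all integers.

  Below, \<open>Sum_any\<close> is only applied to finitely supported families: in the Jacobi identity
  this is due to \<open>truncation\<close> (for the algebra and for the module).

  The underlying space of a weak module is a linear subspace \<open>M\<close> of an ambient space.
  A hypothesis on all weak modules has to name the type of the ambient space, since HOL does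
  not quantify over types. For a \<open>V\<close>-module with underlying type \<open>'w\<close> the theorem uses
  \<open>'w \<Rightarrow> complex\<close>, with arbitrary scalar multiplication and subspace: this type contains the
  full dual, and asking less of the algebra makes the theorem stronger. For nonzero modules
  nothing is lost either: \<open>L(0)\<close> is semisimple on a weak module iff it is so on all its
  cyclic submodules, which have countable dimension and hence embed in \<open>'w \<Rightarrow> complex\<close>.

  The axiom \<open>jacobi\<close>
  is the coefficient of \<open>x\<^sub>0\<^sup>-\<^sup>l\<^sup>-\<^sup>1 x\<^sub>1\<^sup>-\<^sup>m\<^sup>-\<^sup>1 x\<^sub>2\<^sup>-\<^sup>n\<^sup>-\<^sup>1\<close> in the Jacobi identity
  \<open>x\<^sub>0\<^sup>-\<^sup>1 \<delta>((x\<^sub>1-x\<^sub>2)/x\<^sub>0) Y(u,x\<^sub>1) Y(v,x\<^sub>2) - x\<^sub>0\<^sup>-\<^sup>1 \<delta>((x\<^sub>2-x\<^sub>1)/(-x\<^sub>0)) Y(v,x\<^sub>2) Y(u,x\<^sub>1)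
    = x\<^sub>2\<^sup>-\<^sup>1 \<delta>((x\<^sub>1-x\<^sub>0)/x\<^sub>2) Y(Y(u,x\<^sub>0)v,x\<^sub>2)\<close>.
  The right-hand side uses \<open>(-1)\<^sup>i (i-m-1 gchoose i) = (m gchoose i)\<close>.
\<close>

locale weak_module =
  V: vector_space scaleV + M: vector_space scaleM
  for scaleV :: "complex \<Rightarrow> 'v::ab_group_add \<Rightarrow> 'v"
    and Y :: "'v \<Rightarrow> int \<Rightarrow> 'v \<Rightarrow> 'v"
    and vac :: 'v
    and scaleM :: "complex \<Rightarrow> 'm::ab_group_add \<Rightarrow> 'm"
    and M :: "'m set"
    and YM :: "'v \<Rightarrow> int \<Rightarrow> 'm \<Rightarrow> 'm" +
  assumes subspace: "M.subspace M"
    and closed: "w \<in> M \<Longrightarrow> YM v n w \<in> M"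
    and add_left: "w \<in> M \<Longrightarrow> YM (u + v) n w = YM u n w + YM v n w"
    and scale_left: "w \<in> M \<Longrightarrow> YM (scaleV a v) n w = scaleM a (YM v n w)"
    and add_right: "w \<in> M \<Longrightarrow> w' \<in> M \<Longrightarrow> YM v n (w + w') = YM v n w + YM v n w'"
    and scale_right: "w \<in> M \<Longrightarrow> YM v n (scaleM a w) = scaleM a (YM v n w)"
    and truncation: "w \<in> M \<Longrightarrow> \<exists>N. \<forall>n\<ge>N. YM v n w = 0"
    and vacuum: "w \<in> M \<Longrightarrow> YM vac n w = (if n = -1 then w else 0)"
    and jacobi: "w \<in> M \<Longrightarrow>
      Sum_any (\<lambda>i::nat. scaleM ((-1) ^ i * (of_int l gchoose i))
                          (YM u (m + l - int i) (YM v (n + int i) w)))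
    - Sum_any (\<lambda>i::nat. scaleM ((-1) powi l * (-1) ^ i * (of_int l gchoose i))
                          (YM v (n + l - int i) (YM u (m + int i) w)))
    = Sum_any (\<lambda>i::nat. scaleM (of_int m gchoose i)
                          (YM (Y u (l + int i) v) (m + n - int i) w))"

definition virasoro_mode :: "'v \<Rightarrow> ('v \<Rightarrow> int \<Rightarrow> 'm \<Rightarrow> 'm) \<Rightarrow> int \<Rightarrow> 'm \<Rightarrow> 'm" where
  "virasoro_mode \<omega> YM n = YM \<omega> (n + 1)"

definition L0_eigenspace ::
  "'v \<Rightarrow> (complex \<Rightarrow> 'm \<Rightarrow> 'm) \<Rightarrow> 'm set \<Rightarrow> ('v \<Rightarrow> int \<Rightarrow> 'm \<Rightarrow> 'm) \<Rightarrow> complex \<Rightarrow> 'm set" where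
  "L0_eigenspace \<omega> scaleM M YM h = {w \<in> M. virasoro_mode \<omega> YM 0 w = scaleM h w}"

text \<open>
  \<open>M\<close> is the direct sum of its \<open>L(0)\<close>-eigenspaces. The sum of eigenspaces for
  distinct eigenvalues is always direct, so only spanning is required.
\<close>

definition L0_semisimple ::
  "'v \<Rightarrow> (complex \<Rightarrow> 'm::ab_group_add \<Rightarrow> 'm) \<Rightarrow> 'm set \<Rightarrow> ('v \<Rightarrow> int \<Rightarrow> 'm \<Rightarrow> 'm) \<Rightarrow> bool" where
  "L0_semisimple \<omega> scaleM M YM \<longleftrightarrow>
     module.span scaleM (\<Union>h. L0_eigenspace \<omega> scaleM M YM h) = M"

definition finite_dim :: "(complex \<Rightarrow> 'm::ab_group_add \<Rightarrow> 'm) \<Rightarrow> 'm set \<Rightarrow> bool" where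
  "finite_dim scaleM S \<longleftrightarrow> (\<exists>B. finite B \<and> S \<subseteq> module.span scaleM B)"

locale vertex_operator_algebra =
  weak_module scaleV Y vac scaleV UNIV Y
  for scaleV :: "complex \<Rightarrow> 'v::ab_group_add \<Rightarrow> 'v"
    and Y :: "'v \<Rightarrow> int \<Rightarrow> 'v \<Rightarrow> 'v"
    and vac :: 'v +
  fixes \<omega> :: 'v
  assumes creation: "n \<ge> 0 \<Longrightarrow> Y v n vac = 0" "Y v (-1) vac = v"
    and virasoro: "\<exists>c::complex. \<forall>m n v.
          virasoro_mode \<omega> Y m (virasoro_mode \<omega> Y n v)
        - virasoro_mode \<omega> Y n (virasoro_mode \<omega> Y m v)
        = scaleV (of_int (m - n)) (virasoro_mode \<omega> Y (m + n) v)
          + (if m + n = 0 then scaleV (of_int (m ^ 3 - m) / 12 * c) v else 0)"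
    and L_minus1_derivative:
      "Y (virasoro_mode \<omega> Y (-1) v) n w = scaleV (- of_int n) (Y v (n - 1) w)"
    and grading: "module.span scaleV (\<Union>n::int. L0_eigenspace \<omega> scaleV UNIV Y (of_int n)) = UNIV"
    and finite_dim_weight: "finite_dim scaleV (L0_eigenspace \<omega> scaleV UNIV Y (of_int (n::int)))"
    and weights_bounded_below:
      "\<exists>N::int. \<forall>n<N. L0_eigenspace \<omega> scaleV UNIV Y (of_int n) = {0}"

locale ordinary_module =
  weak_module scaleV Y vac scaleW UNIV YW
  for scaleV :: "complex \<Rightarrow> 'v::ab_group_add \<Rightarrow> 'v"
    and Y :: "'v \<Rightarrow> int \<Rightarrow> 'v \<Rightarrow> 'v"
    and vac \<omega> :: 'v
    and scaleW :: "complex \<Rightarrow> 'w::ab_group_add \<Rightarrow> 'w"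
    and YW :: "'v \<Rightarrow> int \<Rightarrow> 'w \<Rightarrow> 'w" +
  assumes semisimple: "L0_semisimple \<omega> scaleW UNIV YW"
    and finite_dim_weight: "finite_dim scaleW (L0_eigenspace \<omega> scaleW UNIV YW h)"
    and weights_bounded_below:
      "\<exists>N::int. \<forall>n<N. L0_eigenspace \<omega> scaleW UNIV YW (h + of_int n) = {0}"

definition full_dual :: "(complex \<Rightarrow> 'w::ab_group_add \<Rightarrow> 'w) \<Rightarrow> ('w \<Rightarrow> complex) set" where
  "full_dual scaleW = {\<alpha>. Vector_Spaces.linear scaleW (*) \<alpha>}"

definition scale_fun :: "complex \<Rightarrow> ('w \<Rightarrow> complex) \<Rightarrow> 'w \<Rightarrow> complex" where
  "scale_fun a \<alpha> = (\<lambda>w. a * \<alpha> w)"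

text \<open>
  The dual of the eigenspace \<open>W\<^sub>h\<close> is embedded in the full dual by extending
  functionals by zero on all other eigenspaces; the restricted dual is the sum of these.
\<close>

definition weight_dual ::
  "'v \<Rightarrow> (complex \<Rightarrow> 'w::ab_group_add \<Rightarrow> 'w) \<Rightarrow> ('v \<Rightarrow> int \<Rightarrow> 'w \<Rightarrow> 'w) \<Rightarrow> complex
     \<Rightarrow> ('w \<Rightarrow> complex) set" where
  "weight_dual \<omega> scaleW YW h =
     {\<alpha> \<in> full_dual scaleW. \<forall>k. k \<noteq> h \<longrightarrow> (\<forall>w \<in> L0_eigenspace \<omega> scaleW UNIV YW k. \<alpha> w = 0)}"

definition restricted_dual ::
  "'v \<Rightarrow> (complex \<Rightarrow> 'w::ab_group_add \<Rightarrow> 'w) \<Rightarrow> ('v \<Rightarrow> int \<Rightarrow> 'w \<Rightarrow> 'w)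
     \<Rightarrow> ('w \<Rightarrow> complex) set" where
  "restricted_dual \<omega> scaleW YW = module.span scale_fun (\<Union>h. weight_dual \<omega> scaleW YW h)"

text \<open>The component of \<open>v\<close> of each weight; unique by the grading of the algebra.\<close>

definition weight_component ::
  "(complex \<Rightarrow> 'v::ab_group_add \<Rightarrow> 'v) \<Rightarrow> ('v \<Rightarrow> int \<Rightarrow> 'v \<Rightarrow> 'v) \<Rightarrow> 'v \<Rightarrow> 'v \<Rightarrow> int \<Rightarrow> 'v" where
  "weight_component scaleV Y \<omega> v =
     (THE f. (\<forall>h. f h \<in> L0_eigenspace \<omega> scaleV UNIV Y (of_int h))
           \<and> finite {h. f h \<noteq> 0} \<and> Sum_any f = v)"

text \<open>
  \<open>opposite_coeff scaleV Y \<omega> v k\<close> is the coefficient of \<open>x\<^sup>k\<close> in the Laurent polynomial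
  \<open>e\<^bsup>xL(1)\<^esup> (-x\<^sup>-\<^sup>2)\<^bsup>L(0)\<^esup> v = \<Sum>\<^sub>h \<Sum>\<^sub>i (-1)\<^sup>h / i! x\<^bsup>i-2h\<^esup> L(1)\<^sup>i v\<^sub>h\<close>,
  where \<open>v\<^sub>h\<close> is the weight \<open>h\<close> component of \<open>v\<close>; so \<open>i = k + 2h\<close>.
\<close>

definition opposite_coeff ::
  "(complex \<Rightarrow> 'v::ab_group_add \<Rightarrow> 'v) \<Rightarrow> ('v \<Rightarrow> int \<Rightarrow> 'v \<Rightarrow> 'v) \<Rightarrow> 'v \<Rightarrow> 'v \<Rightarrow> int \<Rightarrow> 'v" where
  "opposite_coeff scaleV Y \<omega> v k =
     Sum_any (\<lambda>h::int. if k + 2 * h \<ge> 0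
       then scaleV ((-1) powi h / fact (nat (k + 2 * h)))
              ((virasoro_mode \<omega> Y 1 ^^ nat (k + 2 * h)) (weight_component scaleV Y \<omega> v h))
       else 0)"

text \<open>
  The mode \<open>v\<^sup>*\<^sub>n\<close>, the coefficient of \<open>x\<^sup>-\<^sup>n\<^sup>-\<^sup>1\<close> in \<open>Y\<^sup>*(v,x)\<close>: a term \<open>u x\<^sup>k\<close> of
  the Laurent polynomial above contributes \<open>x\<^sup>k Y(u,x\<^sup>-\<^sup>1) = \<Sum>\<^sub>m u\<^sub>m x\<^bsup>k+m+1\<^esup>\<close>,
  so \<open>m = -n-k-2\<close>.
\<close>

definition dual_mode ::
  "(complex \<Rightarrow> 'v::ab_group_add \<Rightarrow> 'v) \<Rightarrow> ('v \<Rightarrow> int \<Rightarrow> 'v \<Rightarrow> 'v) \<Rightarrow> 'v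
     \<Rightarrow> ('v \<Rightarrow> int \<Rightarrow> 'w \<Rightarrow> 'w) \<Rightarrow> 'v \<Rightarrow> int \<Rightarrow> ('w \<Rightarrow> complex) \<Rightarrow> 'w \<Rightarrow> complex" where
  "dual_mode scaleV Y \<omega> YW v n \<alpha> w =
     Sum_any (\<lambda>k::int. \<alpha> (YW (opposite_coeff scaleV Y \<omega> v k) (- n - k - 2) w))"

definition D_space ::
  "(complex \<Rightarrow> 'v::ab_group_add \<Rightarrow> 'v) \<Rightarrow> ('v \<Rightarrow> int \<Rightarrow> 'v \<Rightarrow> 'v) \<Rightarrow> 'v
     \<Rightarrow> (complex \<Rightarrow> 'w::ab_group_add \<Rightarrow> 'w) \<Rightarrow> ('v \<Rightarrow> int \<Rightarrow> 'w \<Rightarrow> 'w) \<Rightarrow> ('w \<Rightarrow> complex) set" where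
  "D_space scaleV Y \<omega> scaleW YW =
     {\<alpha> \<in> full_dual scaleW. \<forall>v. \<exists>N. \<forall>n\<ge>N. dual_mode scaleV Y \<omega> YW v n \<alpha> = 0}"

end

theory Submission
  imports Defs "HOL-Computational_Algebra.Formal_Power_Series"
begin

text \<open>
  The space \<open>D(W)\<close> is itself a weak \<open>V\<close>-module under \<open>Y\<^sup>*\<close>. The identity
  \<open>\<langle>v\<^sup>*\<^sub>n \<alpha>, w\<rangle> = \<langle>\<alpha>, v\<^sup>o\<^sub>n w\<rangle>\<close> with \<open>v\<^sup>o\<^sub>n = (-1)\<^sup>a \<Sum>\<^sub>p (L(1)\<^sup>p v / p!)\<close> in mode
  \<open>2a-2-n-p\<close> (for \<open>v\<close> of weight \<open>a\<close>) turns the Jacobi identity with parameters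
  \<open>l, m, n\<close> for \<open>u\<^sup>*, v\<^sup>*\<close> into the sum, over all \<open>j\<close> and \<open>p\<close>, of the Jacobi identities
  on \<open>W\<close> for \<open>L(1)\<^sup>j u / j!\<close> and \<open>L(1)\<^sup>p v / p!\<close> with parameters
  \<open>l, 2a-2-j-l-m, 2b-2-p-l-n\<close>. The two iterate terms match by the formula for
  \<open>L(1)\<^sup>N (u\<^sub>n v)\<close> and a Vandermonde convolution. Evaluated at a fixed \<open>w\<close>, all sums are
  finite for every functional; \<open>\<alpha> \<in> D(W)\<close> is needed only to make them finite
  uniformly in \<open>w\<close>.

  Since \<open>L(0)\<close> on \<open>D(W)\<close> is the transpose of \<open>L(0)\<close> on \<open>W\<close>, its eigenvectors lie in single
  weight duals, so semisimplicity gives \<open>D(W) \<subseteq> W'\<close>. The other inclusion holds because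
  \<open>v\<^sup>*\<^sub>n\<close> shifts weights and the weights of \<open>W\<close> in a coset of the integers are bounded below.
\<close>

section \<open>Finite sums and their rearrangement\<close>

lemma Sum_any_eq_sum_lessThan:
  fixes f :: "nat \<Rightarrow> 'a::comm_monoid_add"
  assumes "\<And>i. i \<ge> K \<Longrightarrow> f i = 0"
  shows "Sum_any f = sum f {..<K}"
  by (rule Sum_any.expand_superset) (use assms leI in auto)

lemma Sum_any_eq_single:
  assumes "\<And>i. i \<noteq> k \<Longrightarrow> f i = 0"
  shows "Sum_any f = f k"
  by (subst Sum_any.expand_superset[of "{k}"]) (use assms in auto)

text \<open>Index set for the degree \<open>N\<close> part of a product of three factors:
  \<open>j\<close> and \<open>p\<close> count powers of \<open>L(1)\<close> on the two vectors,
  \<open>r\<close> is the mode shift.\<close>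

definition triples :: "nat \<Rightarrow> (nat \<times> nat \<times> nat) set" where
  "triples N = {(j, r, p). j + r + p = N}"

lemma finite_triples: "finite (triples N)"
  by (rule finite_subset[of _ "{..N} \<times> {..N} \<times> {..N}"]) (auto simp: triples_def)

text \<open>\<open>L(1)\<close> applied to a product of modes raises one of the three exponents at a
  time. Padding with zeros where the raised exponent is 0 brings all three resulting sums to the
  same index set, so that coefficients can be compared.\<close>

lemma sum_triples_shift:
  fixes f :: "nat \<Rightarrow> nat \<Rightarrow> nat \<Rightarrow> 'a::comm_monoid_add"
  shows sum_triples_shift1:
      "(\<Sum>(j, r, p)\<in>triples N. f (Suc j) r p)
        = (\<Sum>(j, r, p)\<in>triples (Suc N). if j = 0 then 0 else f j r p)" (is ?A)
    and sum_triples_shift2: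
      "(\<Sum>(j, r, p)\<in>triples N. f j (Suc r) p)
        = (\<Sum>(j, r, p)\<in>triples (Suc N). if r = 0 then 0 else f j r p)" (is ?B)
    and sum_triples_shift3:
      "(\<Sum>(j, r, p)\<in>triples N. f j r (Suc p))
        = (\<Sum>(j, r, p)\<in>triples (Suc N). if p = 0 then 0 else f j r p)" (is ?C)
proof -
  show ?A
    by (rule sum.reindex_bij_witness_not_neutral[
          where S' = "{}" and T' = "{x \<in> triples (Suc N). fst x = 0}"
            and i = "\<lambda>(j, r, p). (j - 1, r, p)" and j = "\<lambda>(j, r, p). (Suc j, r, p)"])
       (auto simp: triples_def intro: finite_subset[OF _ finite_triples[of "Suc N"]])
  show ?B
    by (rule sum.reindex_bij_witness_not_neutral[
          where S' = "{}" and T' = "{x \<in> triples (Suc N). fst (snd x) = 0}"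
            and i = "\<lambda>(j, r, p). (j, r - 1, p)" and j = "\<lambda>(j, r, p). (j, Suc r, p)"])
       (auto simp: triples_def intro: finite_subset[OF _ finite_triples[of "Suc N"]])
  show ?C
    by (rule sum.reindex_bij_witness_not_neutral[
          where S' = "{}" and T' = "{x \<in> triples (Suc N). snd (snd x) = 0}"
            and i = "\<lambda>(j, r, p). (j, r, p - 1)" and j = "\<lambda>(j, r, p). (j, r, Suc p)"])
       (auto simp: triples_def intro: finite_subset[OF _ finite_triples[of "Suc N"]])
qed

text \<open>Every triple inside the box has total degree below \<open>J + K + P\<close>, so cutting
  the sum over degrees there loses nothing.\<close>

lemma sum_triples_box:
  fixes g :: "nat \<Rightarrow> nat \<Rightarrow> nat \<Rightarrow> 'a::comm_monoid_add"
  assumes "\<And>j r p. j \<ge> J \<or> r \<ge> K \<or> p \<ge> P \<Longrightarrow> g j r p = 0"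
  shows "(\<Sum>N<J + K + P. \<Sum>(j, r, p)\<in>triples N. g j r p) = (\<Sum>j<J. \<Sum>p<P. \<Sum>r<K. g j r p)"
proof -
  have "(\<Sum>N<J + K + P. \<Sum>(j, r, p)\<in>triples N. g j r p)
      = (\<Sum>(N, j, r, p)\<in>Sigma {..<J + K + P} triples. g j r p)"
    by (rule sum.Sigma) (simp_all add: finite_triples)
  also have "\<dots> = (\<Sum>(j, p, r)\<in>{..<J} \<times> {..<P} \<times> {..<K}. g j r p)"
    by (rule sum.reindex_bij_witness_not_neutral[
          where S' = "{(N, j, r, p) \<in> Sigma {..<J + K + P} triples. j \<ge> J \<or> r \<ge> K \<or> p \<ge> P}"
            and T' = "{}" and i = "\<lambda>(j, p, r). (j + r + p, j, r, p)" and j = "\<lambda>(N, j, r, p). (j, p, r)"])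
       (use assms in \<open>auto simp: triples_def finite_triples[unfolded triples_def]
          intro: finite_subset[of _ "Sigma {..<J + K + P} triples"]\<close>)
  finally show ?thesis
    by (simp add: sum.cartesian_product)
qed

text \<open>Only the triangle \<open>i + r < K\<close> of the square contributes. It is summed along
  the diagonals \<open>s = i + r\<close>, on which the convolution of binomial coefficients takes
  place.\<close>

lemma sum_square_eq_sum_diagonals:
  fixes g :: "nat \<Rightarrow> nat \<Rightarrow> 'a::comm_monoid_add"
  assumes "\<And>i r. i + r \<ge> K \<Longrightarrow> g i r = 0"
  shows "(\<Sum>i<K. \<Sum>r<K. g i r) = (\<Sum>s<K. \<Sum>i\<le>s. g i (s - i))"
proof -
  have "(\<Sum>i<K. \<Sum>r<K. g i r) = (\<Sum>(i, r)\<in>{..<K} \<times> {..<K}. g i r)"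
    by (rule sum.cartesian_product)
  also have "\<dots> = (\<Sum>(i, r)\<in>{(i, r). i + r < K}. g i r)"
    by (rule sum.mono_neutral_right) (auto, use assms not_le in blast)
  finally show ?thesis by (simp add: sum.triangle_reindex)
qed

lemma finite_support_if_eventually_zero:
  assumes "\<forall>\<^sub>F i in sequentially. f i = 0"
  shows "finite {i. f i \<noteq> 0}"
proof -
  obtain N where "\<And>i. i \<ge> N \<Longrightarrow> f i = 0"
    using assms by (auto simp: eventually_sequentially)
  then have "{i. f i \<noteq> 0} \<subseteq> {..<N}" by (metis (mono_tags) lessThan_iff mem_Collect_eq not_le subsetI)
  then show ?thesis by (rule finite_subset) simp
qed

lemma additive_Sum_any:
  fixes f :: "'a::comm_monoid_add \<Rightarrow> 'b::comm_monoid_add"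
  assumes "\<And>x y. f (x + y) = f x + f y" "f 0 = 0" "finite {i. g i \<noteq> 0}"
  shows "f (Sum_any g) = Sum_any (\<lambda>i. f (g i))"
proof -
  have "f (Sum_any g) = f (sum g {i. g i \<noteq> 0})"
    by (simp add: Sum_any.expand_set)
  also have "\<dots> = (\<Sum>i\<in>{i. g i \<noteq> 0}. f (g i))"
    using assms(3) by (induction rule: finite_induct) (auto simp: assms(1,2))
  also have "\<dots> = Sum_any (\<lambda>i. f (g i))"
    by (rule Sum_any.expand_superset[symmetric]) (use assms in auto)
  finally show ?thesis .
qed

section \<open>Binomial identities\<close>

text \<open>Coefficient of \<open>z^s\<close> in
  \<open>(1+z)^X (1 - z/(1+z))^m = (1+z)^(X-m)\<close>. In the proof, negating the upper index turns
  \<open>X - i\<close> into \<open>s - X - 1\<close>, which no longer depends on \<open>i\<close>,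
  so that Vandermonde applies.\<close>

lemma gbinomial_alternating_convolution:
  fixes m X :: "'a::field_char_0"
  shows "(\<Sum>i\<le>s. (-1) ^ i * (m gchoose i) * (X - of_nat i gchoose (s - i))) = (X - m gchoose s)"
proof -
  have "(\<Sum>i\<le>s. (-1) ^ i * (m gchoose i) * (X - of_nat i gchoose (s - i)))
      = (\<Sum>i\<le>s. (-1) ^ s * ((m gchoose i) * (of_nat s - X - 1 gchoose (s - i))))"
  proof (rule sum.cong)
    fix i assume "i \<in> {..s}"
    then have i: "i \<le> s" by simp
    have "(X - of_nat i gchoose (s - i)) = (-1) ^ (s - i) * (of_nat s - X - 1 gchoose (s - i))"
      by (subst gbinomial_negated_upper) (simp add: i of_nat_diff algebra_simps)
    moreover have "(-1 :: 'a) ^ s = (-1) ^ i * (-1) ^ (s - i)"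
      using i by (simp flip: power_add)
    ultimately show "(-1) ^ i * (m gchoose i) * (X - of_nat i gchoose (s - i))
        = (-1) ^ s * ((m gchoose i) * (of_nat s - X - 1 gchoose (s - i)))"
      by simp
  qed simp
  also have "\<dots> = (-1) ^ s * (m + (of_nat s - X - 1) gchoose s)"
    by (simp add: gbinomial_Vandermonde atMost_atLeast0 flip: sum_distrib_left)
  also have "\<dots> = (X - m gchoose s)"
    by (subst (2) gbinomial_negated_upper) (simp add: algebra_simps)
  finally show ?thesis .
qed

text \<open>The coefficient comparison in the induction step of \<open>L1_div_mode\<close>; the
  three summands come from raising \<open>j\<close>, \<open>r\<close> and \<open>p\<close>. It
  combines Pascal's rule with the absorption identity for the upper index
  \<open>X - j\<close>.\<close>

lemma gbinomial_triple_recurrence: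
  fixes X :: "'a::field_char_0"
  shows "(if j = 0 then 0 else of_nat j * (X - of_nat (j - 1) gchoose r))
      + ((if r = 0 then 0 else (X - 2 * of_nat j - of_nat (r - 1)) * (X - of_nat j gchoose (r - 1)))
      + (if p = 0 then 0 else of_nat p * (X - of_nat j gchoose r)))
    = of_nat (j + r + p) * (X - of_nat j gchoose r)"
proof (cases r)
  case (Suc q)
  define A where "A = X - of_nat j"
  have 1: "(if j = 0 then 0 else of_nat j * (X - of_nat (j - 1) gchoose r))
      = of_nat j * ((A gchoose q) + (A gchoose Suc q))"
    using gbinomial_Suc_Suc[of A q] by (cases j) (auto simp: A_def Suc algebra_simps)
  have 2: "of_nat (Suc q) * (A gchoose Suc q) = (A - of_nat q) * (A gchoose q)"
    using gbinomial_mult_1[of A q] by (simp add: algebra_simps)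
  have "of_nat j * ((A gchoose q) + (A gchoose Suc q))
      + ((A - of_nat j - of_nat q) * (A gchoose q) + of_nat p * (A gchoose Suc q))
      = of_nat j * (A gchoose Suc q) + of_nat (Suc q) * (A gchoose Suc q) + of_nat p * (A gchoose Suc q)"
    unfolding 2 by (simp add: algebra_simps)
  then show ?thesis
    unfolding 1 by (simp add: Suc A_def algebra_simps)
qed auto

section \<open>Linear algebra: functions as vectors, independence of eigenvectors\<close>

lemma vector_space_scale_fun: "vector_space scale_fun"
  by unfold_locales (auto simp: scale_fun_def fun_eq_iff algebra_simps)

lemma eigenvectors_sum_zero:
  fixes T :: "'b::ab_group_add \<Rightarrow> 'b" and c :: "'i \<Rightarrow> 'k::field"
  assumes "vector_space scale"
    and add: "\<And>x y. T (x + y) = T x + T y" and scl: "\<And>a x. T (scale a x) = scale a (T x)"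
    and "finite A" "inj_on c A" "\<And>i. i \<in> A \<Longrightarrow> T (x i) = scale (c i) (x i)" "sum x A = 0"
  shows "\<forall>i\<in>A. x i = 0"
  using assms(4-7)
proof (induction arbitrary: x rule: finite_induct)
  interpret vector_space scale by fact
  case (insert a A)
  \<comment> \<open>\<open>y i\<close> is the image of \<open>x i\<close> under
    \<open>T - c a\<close>. This removes the \<open>a\<close> term from the relation and multiplies
    each other term by a nonzero scalar, so the induction hypothesis applies to
    \<open>y\<close>.\<close>
  define y where "y i = scale (c i - c a) (x i)" for i
  have T0: "T 0 = 0" using scl[of 0 0] by simp
  have Tsum: "T (sum x B) = (\<Sum>i\<in>B. T (x i))" if "finite B" for B
    using that by (induction rule: finite_induct) (auto simp: add T0)
  have "sum y (insert a A) = (\<Sum>i\<in>insert a A. T (x i)) - scale (c a) (sum x (insert a A))"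
    by (simp only: y_def[abs_def] scale_left_diff_distrib sum_subtractf scale_sum_right)
       (simp only: insert.prems(2) cong: sum.cong)
  also have "\<dots> = 0"
    using Tsum[of "insert a A"] insert.hyps insert.prems(3) T0 by simp
  finally have "sum y A = 0" using insert.hyps by (simp add: y_def)
  moreover have "T (y i) = scale (c i) (y i)" if "i \<in> A" for i
    using that insert.prems(2) by (simp add: y_def scl mult.commute)
  ultimately have "\<forall>i\<in>A. y i = 0"
    using insert.IH[of y] insert.prems(1) by auto
  moreover have "c i \<noteq> c a" if "i \<in> A" for i
    using that insert.hyps insert.prems(1) by (auto simp: inj_on_def)
  ultimately have "\<forall>i\<in>A. x i = 0" by (auto simp: y_def)
  then show ?case using insert by auto
qed auto


section \<open>Consequences of the axioms of a weak module\<close>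

context weak_module
begin

lemma zero_right: "YM v n 0 = 0"
  using scale_right[of 0 v n 0] M.subspace_0[OF subspace] by simp

lemma zero_left: "w \<in> M \<Longrightarrow> YM 0 n w = 0"
  using scale_left[of w 0 0 n] by simp

lemma sum_left: "w \<in> M \<Longrightarrow> YM (sum f A) n w = (\<Sum>i\<in>A. YM (f i) n w)"
  by (induction A rule: infinite_finite_induct) (auto simp: add_left zero_left)

lemma sum_right:
  "(\<And>i. i \<in> A \<Longrightarrow> f i \<in> M) \<Longrightarrow> YM v n (sum f A) = (\<Sum>i\<in>A. YM v n (f i))"
proof (induction A rule: infinite_finite_induct)
  case (insert x A)
  then have "sum f A \<in> M" by (intro M.subspace_sum[OF subspace]) simp
  with insert show ?case by (simp add: add_right)
qed (simp_all add: zero_right)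

lemma eventually_mode_zero: "w \<in> M \<Longrightarrow> \<forall>\<^sub>F i in sequentially. YM v (c + int i) w = 0"
proof -
  assume "w \<in> M"
  then obtain N where N: "\<And>n. n \<ge> N \<Longrightarrow> YM v n w = 0"
    using truncation by blast
  show ?thesis
    by (rule eventually_sequentiallyI[of "nat (N - c)"]) (auto intro!: N)
qed

text \<open>The case \<open>l = 0\<close> of the Jacobi identity: \<open>0 gchoose i\<close> leaves
  only \<open>i = 0\<close> on the left, and a nonnegative upper index makes the right-hand side an
  ordinary finite sum.\<close>

lemma mode_commutator:
  assumes "w \<in> M"
  shows "YM u (int m) (YM v n w) - YM v n (YM u (int m) w)
       = (\<Sum>i\<le>m. scaleM (of_nat (m choose i)) (YM (Y u (int i) v) (int m + n - int i) w))"
proof -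
  have eq0: "Sum_any (\<lambda>i::nat. scaleM (d i * (0 gchoose i)) (f i)) = scaleM (d 0) (f 0)"
    for f :: "nat \<Rightarrow> 'm" and d :: "nat \<Rightarrow> complex"
    by (subst Sum_any_eq_sum_lessThan[of 1]) (auto simp: gbinomial_0_left)
  have "Sum_any (\<lambda>i. scaleM (of_int (int m) gchoose i) (YM (Y u (0 + int i) v) (int m + n - int i) w))
      = (\<Sum>i\<le>m. scaleM (of_nat (m choose i)) (YM (Y u (int i) v) (int m + n - int i) w))"
    by (subst Sum_any_eq_sum_lessThan[of "Suc m"])
       (auto simp: lessThan_Suc_atMost simp flip: binomial_gbinomial)
  then show ?thesis
    using jacobi[OF assms, of 0 u "int m" v n] eq0[of "\<lambda>i. (-1) ^ i"]
    by simp
qed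

end

section \<open>Virasoro commutators and weights\<close>

context vertex_operator_algebra
begin

abbreviation L :: "int \<Rightarrow> 'v \<Rightarrow> 'v" where
  "L \<equiv> virasoro_mode \<omega> Y"

abbreviation weight :: "int \<Rightarrow> 'v set" where
  "weight a \<equiv> L0_eigenspace \<omega> scaleV UNIV Y (of_int a)"

text \<open>The derivative property is an axiom for the algebra only. On a weak module it follows
  from \<open>L(-1) v = v\<^sub>-\<^sub>2 vac\<close> and the Jacobi identity with
  \<open>l = -2\<close>, \<open>m = 0\<close> and second vector \<open>vac\<close>: each of the two
  sums on the left then has at most one nonzero term.\<close>

lemma L_minus1_mode:
  assumes "weak_module scaleV Y vac scaleM M YM" "w \<in> M"
  shows "YM (L (-1) v) n w = scaleM (- of_int n) (YM v (n - 1) w)"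
proof -
  interpret N: weak_module scaleV Y vac scaleM M YM by fact
  have v: "L (-1) v = Y v (-2) vac"
    using L_minus1_derivative[of v "-1" vac] creation(2) by simp
  have binom: "(-1) ^ i * ((-2 :: complex) gchoose i) = of_nat (Suc i)" for i
    by (subst gbinomial_minus) (simp add: binomial_gbinomial[symmetric, of "Suc i" i, simplified])
  have "YM (Y v (-2) vac) n w
      = Sum_any (\<lambda>i. scaleM (of_nat (Suc i)) (YM v (- 2 - int i) (YM vac (n + int i) w)))
      - Sum_any (\<lambda>i. scaleM (of_nat (Suc i)) (YM vac (n - 2 - int i) (YM v (int i) w)))"
    using N.jacobi[OF assms(2), of "-2" v 0 vac n]
      Sum_any_eq_single[of 0 "\<lambda>i. scaleM (0 gchoose i) (YM (Y v (- 2 + int i) vac) (n - int i) w)"]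
    by (simp add: binom gbinomial_0_left mult.assoc)
  also have "Sum_any (\<lambda>i. scaleM (of_nat (Suc i)) (YM v (- 2 - int i) (YM vac (n + int i) w)))
      = (if n < 0 then scaleM (- of_int n) (YM v (n - 1) w) else 0)"
    \<comment> \<open>The vacuum mode \<open>n + i\<close> acts nontrivially only at
      \<open>i = -1 - n\<close>. For \<open>n \<ge> 0\<close> the witness degenerates to 0, where
      the term vanishes too; the same happens below for \<open>n \<le> 0\<close>.\<close>
    by (subst Sum_any_eq_single[of "nat (- 1 - n)"])
       (use assms(2) in \<open>auto simp: N.vacuum N.zero_right of_nat_nat\<close>)
  also have "Sum_any (\<lambda>i. scaleM (of_nat (Suc i)) (YM vac (n - 2 - int i) (YM v (int i) w)))
      = (if n > 0 then scaleM (of_int n) (YM v (n - 1) w) else 0)"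
    by (subst Sum_any_eq_single[of "nat (n - 1)"])
       (use assms(2) in \<open>auto simp: N.vacuum N.closed of_nat_nat\<close>)
  finally show ?thesis
    by (auto simp: v)
qed

text \<open>Since \<open>L(0)\<close> is mode 1 of \<open>\<omega>\<close>, the commutator formula
  has only the terms \<open>i = 0\<close> and \<open>i = 1\<close>; the first one involves
  \<open>L(-1) v\<close> and becomes a multiple of a mode of \<open>v\<close>. The case of
  \<open>L(1)\<close>, mode 2, has one more term.\<close>

lemma L0_commutator:
  assumes "weak_module scaleV Y vac scaleM M YM" "w \<in> M"
  shows "virasoro_mode \<omega> YM 0 (YM v n w) - YM v n (virasoro_mode \<omega> YM 0 w)
       = YM (L 0 v) n w - scaleM (of_int (n + 1)) (YM v n w)"
proof -
  interpret N: weak_module scaleV Y vac scaleM M YM by fact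
  have "virasoro_mode \<omega> YM 0 (YM v n w) - YM v n (virasoro_mode \<omega> YM 0 w)
      = YM (L (-1) v) (n + 1) w + YM (L 0 v) n w"
    using N.mode_commutator[OF assms(2), of \<omega> 1 v n] by (simp add: virasoro_mode_def add.commute)
  then show ?thesis
    by (simp only: L_minus1_mode[OF assms]) (simp add: algebra_simps)
qed

lemma L1_commutator:
  assumes "weak_module scaleV Y vac scaleM M YM" "w \<in> M"
  shows "virasoro_mode \<omega> YM 1 (YM v n w) - YM v n (virasoro_mode \<omega> YM 1 w)
       = YM (L 1 v) n w + scaleM 2 (YM (L 0 v) (n + 1) w) - scaleM (of_int (n + 2)) (YM v (n + 1) w)"
proof -
  interpret N: weak_module scaleV Y vac scaleM M YM by fact
  have "virasoro_mode \<omega> YM 1 (YM v n w) - YM v n (virasoro_mode \<omega> YM 1 w)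
      = YM (L (-1) v) (n + 2) w + scaleM 2 (YM (L 0 v) (n + 1) w) + YM (L 1 v) n w"
    using N.mode_commutator[OF assms(2), of \<omega> 2 v n]
    by (simp add: virasoro_mode_def add.commute numeral_2_eq_2)
  then show ?thesis
    by (simp only: L_minus1_mode[OF assms]) (simp add: algebra_simps)
qed

lemma mode_weight:
  assumes M: "weak_module scaleV Y vac scaleM M YM"
    and v: "v \<in> weight a" and w: "w \<in> L0_eigenspace \<omega> scaleM M YM h"
  shows "YM v n w \<in> L0_eigenspace \<omega> scaleM M YM (h + of_int (a - n - 1))"
proof -
  interpret N: weak_module scaleV Y vac scaleM M YM by fact
  have "w \<in> M" using w by (simp add: L0_eigenspace_def)
  from L0_commutator[OF M this, of v n] show ?thesis
    using v w \<open>w \<in> M\<close>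
    by (simp add: L0_eigenspace_def N.closed N.scale_right N.scale_left algebra_simps)
qed

text \<open>\<open>\<omega> = L(-2) vac\<close>, and \<open>[L(0), L(-2)] = 2 L(-2)\<close> is
  applied to the vacuum, which \<open>L(0)\<close> kills. Likewise
  \<open>[L(1), L(-2)] = 3 L(-1)\<close> gives the vanishing of \<open>L(1) \<omega>\<close>
  below.\<close>

lemma conformal_vector_weight: "\<omega> \<in> weight 2"
proof -
  obtain c where "\<And>m n v. L m (L n v) - L n (L m v)
      = scaleV (of_int (m - n)) (L (m + n) v)
        + (if m + n = 0 then scaleV (of_int (m ^ 3 - m) / 12 * c) v else 0)"
    using virasoro by blast
  from this[of 0 "-2" vac] show ?thesis
    by (simp add: L0_eigenspace_def virasoro_mode_def creation zero_right)
qed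

lemma L1_conformal_vector: "L 1 \<omega> = 0"
proof -
  obtain c where "\<And>m n v. L m (L n v) - L n (L m v)
      = scaleV (of_int (m - n)) (L (m + n) v)
        + (if m + n = 0 then scaleV (of_int (m ^ 3 - m) / 12 * c) v else 0)"
    using virasoro by blast
  from this[of 1 "-2" vac] show ?thesis
    by (simp add: virasoro_mode_def creation zero_right)
qed

lemma vacuum_weight: "vac \<in> weight 0" and L1_vacuum: "L 1 vac = 0"
  by (simp_all add: L0_eigenspace_def virasoro_mode_def creation)

section \<open>Divided powers of \<open>L(1)\<close> and their action on products\<close>

text \<open>The coefficient of \<open>x^p\<close> in \<open>e^(xL(1)) v\<close>.\<close>

definition L1_div :: "nat \<Rightarrow> 'v \<Rightarrow> 'v" where
  "L1_div p v = scaleV (1 / fact p) ((L 1 ^^ p) v)"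

lemma L1_add: "L 1 (u + v) = L 1 u + L 1 v" and L1_scale: "L 1 (scaleV c v) = scaleV c (L 1 v)"
  by (simp_all add: virasoro_mode_def add_right scale_right)

lemma L1_div_0 [simp]: "L1_div 0 v = v"
  by (simp add: L1_div_def)

lemma L1_L1_div: "L 1 (L1_div p v) = scaleV (of_nat (Suc p)) (L1_div (Suc p) v)"
  by (simp add: L1_div_def L1_scale del: of_nat_Suc)

lemma L1_div_add: "L1_div p (u + v) = L1_div p u + L1_div p v"
proof -
  have "(L 1 ^^ p) (u + v) = (L 1 ^^ p) u + (L 1 ^^ p) v"
    by (induction p) (simp_all add: L1_add)
  then show ?thesis by (simp add: L1_div_def V.scale_right_distrib)
qed

lemma L1_div_scale: "L1_div p (scaleV c v) = scaleV c (L1_div p v)"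
proof -
  have "(L 1 ^^ p) (scaleV c v) = scaleV c ((L 1 ^^ p) v)"
    by (induction p) (simp_all add: L1_scale)
  then show ?thesis by (simp add: L1_div_def mult.commute)
qed

lemma L1_div_eq_0: "L 1 v = 0 \<Longrightarrow> p \<ge> 1 \<Longrightarrow> L1_div p v = 0"
proof (induction p)
  case (Suc p)
  have "scaleV (of_nat (Suc p)) (L1_div (Suc p) v) = L 1 (L1_div p v)"
    by (simp add: L1_L1_div)
  also have "\<dots> = 0" using Suc by (cases p) (auto simp: virasoro_mode_def zero_right)
  finally show ?case by (simp del: of_nat_Suc)
qed simp

lemma weight_scale: "v \<in> weight a \<Longrightarrow> scaleV c v \<in> weight a"
  by (simp add: L0_eigenspace_def virasoro_mode_def scale_right mult.commute)

lemma zero_weight: "0 \<in> weight a"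
  by (simp add: L0_eigenspace_def virasoro_mode_def zero_right)

lemma weight_add: "u \<in> weight a \<Longrightarrow> v \<in> weight a \<Longrightarrow> u + v \<in> weight a"
  by (simp add: L0_eigenspace_def virasoro_mode_def add_right V.scale_right_distrib)

lemma L1_weight: "v \<in> weight a \<Longrightarrow> L 1 v \<in> weight (a - 1)"
  using mode_weight[OF weak_module_axioms conformal_vector_weight, of v "of_int a" 2]
  by (simp add: virasoro_mode_def)

lemma L1_div_weight: "v \<in> weight a \<Longrightarrow> L1_div p v \<in> weight (a - int p)"
proof -
  assume "v \<in> weight a"
  then have "(L 1 ^^ p) v \<in> weight (a - int p)"
  proof (induction p)
    case (Suc p)
    then show ?case using L1_weight[of "(L 1 ^^ p) v" "a - int p"] by (simp add: algebra_simps)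
  qed simp
  then show ?thesis unfolding L1_div_def by (rule weight_scale)
qed

text \<open>The grading writes \<open>v\<close> as a linear combination of homogeneous vectors.
  Scalars are absorbed by the weight spaces, so a property has to be additive only.\<close>

lemma homogeneous_induct:
  assumes hom: "\<And>a v. v \<in> weight a \<Longrightarrow> P v"
    and add: "\<And>u v. P u \<Longrightarrow> P v \<Longrightarrow> P (u + v)"
  shows "P v"
proof -
  have "v \<in> V.span (\<Union>n. weight n)" using grading by simp
  then show ?thesis
  proof (induction rule: V.span_induct_alt)
    case base
    show ?case by (rule hom[OF zero_weight])
  next
    case (step c x y)
    then show ?case using hom[OF weight_scale] add by blast
  qed
qed

text \<open>\<open>L(1)\<close> lowers the weight by 1 and the weights are bounded below; hence
  \<open>e^(xL(1)) v\<close> is a polynomial in \<open>x\<close>.\<close>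

lemma L1_div_eventually_zero: "\<forall>\<^sub>F p in sequentially. L1_div p v = 0"
proof (induction v rule: homogeneous_induct)
  case (1 a v)
  obtain N where N: "\<And>n. n < N \<Longrightarrow> weight n = {0}"
    using weights_bounded_below by blast
  show ?case
  proof (rule eventually_sequentiallyI)
    fix p assume "p \<ge> nat (a - N + 1)"
    then show "L1_div p v = 0"
      using L1_div_weight[OF 1, of p] N[of "a - int p"] by auto
  qed
next
  case (2 u v)
  then show ?case by eventually_elim (simp add: L1_div_add)
qed


text \<open>
  The coefficientwise form of the conjugation formula
  \<open>e\<^bsup>xL(1)\<^esup> Y(u,z) e\<^bsup>-xL(1)\<^esup>
    = Y(e\<^bsup>x(1-xz)L(1)\<^esup> (1-xz)\<^bsup>-2L(0)\<^esup> u, z/(1-xz))\<close>.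
\<close>

lemma L1_div_mode:
  assumes u: "u \<in> weight a"
  shows "L1_div N (Y u n v) = (\<Sum>(j, r, p)\<in>triples N.
      scaleV (of_int (2 * a - n - 2 - int j) gchoose r) (Y (L1_div j u) (n + int r) (L1_div p v)))"
proof (induction N)
  case 0
  have "triples 0 = {(0, 0, 0)}" by (auto simp: triples_def)
  then show ?case by simp
next
  case (Suc N)
  define X :: complex where "X = of_int (2 * a - n - 2)"
  define B where "B j r p = Y (L1_div j u) (n + int r) (L1_div p v)" for j r p
  \<comment> \<open>By \<open>L1_commutator\<close>, \<open>L(1)\<close> acts as a derivation up to
    a term in the next higher mode. As \<open>L1_div j u\<close> has weight \<open>a - j\<close>,
    that term has the coefficient \<open>2(a - j) - (n + r + 2) = X - 2j - r\<close>.\<close>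
  have L1_B: "L 1 (B j r p) = scaleV (of_nat (Suc j)) (B (Suc j) r p)
      + (scaleV (X - 2 * of_nat j - of_nat r) (B j (Suc r) p)
      + scaleV (of_nat (Suc p)) (B j r (Suc p)))" for j r p
  proof -
    have "L 0 (L1_div j u) = scaleV (of_int (a - int j)) (L1_div j u)"
      using L1_div_weight[OF u, of j] by (simp add: L0_eigenspace_def)
    moreover have "scaleV (X - 2 * of_nat j - of_nat r) (B j (Suc r) p)
        = scaleV 2 (scaleV (of_int (a - int j)) (B j (Suc r) p))
        - scaleV (of_int (n + int r + 2)) (B j (Suc r) p)"
      unfolding V.scale_left_diff_distrib[symmetric] V.scale_scale
      by (rule arg_cong[where f = "\<lambda>c. scaleV c _"]) (simp add: X_def)
    moreover have "L 1 (B j r p) = scaleV (of_nat (Suc j)) (B (Suc j) r p)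
        + scaleV 2 (Y (L 0 (L1_div j u)) (n + int (Suc r)) (L1_div p v))
        - scaleV (of_int (n + int r + 2)) (B j (Suc r) p) + scaleV (of_nat (Suc p)) (B j r (Suc p))"
    proof -
      have "n + int r + 1 = n + int (Suc r)" by simp
      with L1_commutator[OF weak_module_axioms, of "L1_div p v" "L1_div j u" "n + int r"]
      show ?thesis
        by (simp only: B_def L1_L1_div scale_left scale_right UNIV_I diff_eq_eq)
    qed
    ultimately show ?thesis
      by (simp only: B_def scale_left UNIV_I) (simp only: add_diff_eq diff_add_eq add.assoc)
  qed
  \<comment> \<open>Passing from degree \<open>N\<close> to \<open>N + 1\<close> by
    \<open>L(1)\<close> costs the factor \<open>N + 1\<close>, which reappears on the right through
    the recurrence and is cancelled at the end.\<close>
  have "scaleV (of_nat (Suc N)) (L1_div (Suc N) (Y u n v)) = L 1 (L1_div N (Y u n v))"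
    by (simp add: L1_L1_div)
  also have "\<dots> = (\<Sum>(j, r, p)\<in>triples N. scaleV (X - of_nat j gchoose r) (L 1 (B j r p)))"
    unfolding Suc.IH virasoro_mode_def
    by (simp add: sum_right scale_right B_def X_def case_prod_beta)
  also have "\<dots> = (\<Sum>(j, r, p)\<in>triples N.
        scaleV (of_nat (Suc j) * (X - of_nat j gchoose r)) (B (Suc j) r p))
      + ((\<Sum>(j, r, p)\<in>triples N.
        scaleV ((X - 2 * of_nat j - of_nat r) * (X - of_nat j gchoose r)) (B j (Suc r) p))
      + (\<Sum>(j, r, p)\<in>triples N.
        scaleV (of_nat (Suc p) * (X - of_nat j gchoose r)) (B j r (Suc p))))"
    unfolding sum.distrib[symmetric]
    by (rule sum.cong)
       (auto simp: L1_B V.scale_right_distrib mult.commute simp del: of_nat_Suc)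
  also have "\<dots> = (\<Sum>(j, r, p)\<in>triples (Suc N). if j = 0 then 0 else
        scaleV (of_nat j * (X - of_nat (j - 1) gchoose r)) (B j r p))
      + ((\<Sum>(j, r, p)\<in>triples (Suc N). if r = 0 then 0 else
        scaleV ((X - 2 * of_nat j - of_nat (r - 1)) * (X - of_nat j gchoose (r - 1))) (B j r p))
      + (\<Sum>(j, r, p)\<in>triples (Suc N). if p = 0 then 0 else
        scaleV (of_nat p * (X - of_nat j gchoose r)) (B j r p)))"
    by (simp only: sum_triples_shift1[symmetric] sum_triples_shift2[symmetric]
          sum_triples_shift3[symmetric] diff_Suc_1)
  also have "\<dots> = (\<Sum>(j, r, p)\<in>triples (Suc N).
        scaleV (of_nat (Suc N) * (X - of_nat j gchoose r)) (B j r p))"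
    unfolding sum.distrib[symmetric]
  proof (rule sum.cong[OF refl], clarify)
    fix j r p assume "(j, r, p) \<in> triples (Suc N)"
    then have "j + r + p = Suc N" by (simp add: triples_def)
    then show "(if j = 0 then 0 else scaleV (of_nat j * (X - of_nat (j - 1) gchoose r)) (B j r p))
      + ((if r = 0 then 0 else
            scaleV ((X - 2 * of_nat j - of_nat (r - 1)) * (X - of_nat j gchoose (r - 1))) (B j r p))
      + (if p = 0 then 0 else scaleV (of_nat p * (X - of_nat j gchoose r)) (B j r p)))
      = scaleV (of_nat (Suc N) * (X - of_nat j gchoose r)) (B j r p)"
      using gbinomial_triple_recurrence[of j X r p, symmetric]
      by (simp only: V.scale_left_distrib V.scale_zero_left if_distrib[of "\<lambda>c. scaleV c _"])
  qed
  also have "\<dots> = scaleV (of_nat (Suc N)) (\<Sum>(j, r, p)\<in>triples (Suc N).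
        scaleV (X - of_nat j gchoose r) (B j r p))"
    by (simp add: V.scale_sum_right case_prod_beta)
  finally show ?case
    by (simp add: X_def B_def del: of_nat_Suc)
qed


section \<open>Weight components and the coefficients of the opposite vertex operator\<close>

text \<open>The predicate under the description operator of \<open>weight_component\<close>, named
  so that existence and uniqueness can be proved for it.\<close>

definition is_weight_decomposition :: "'v \<Rightarrow> (int \<Rightarrow> 'v) \<Rightarrow> bool" where
  "is_weight_decomposition v f \<longleftrightarrow>
     (\<forall>h. f h \<in> weight h) \<and> finite {h. f h \<noteq> 0} \<and> Sum_any f = v"

lemma is_weight_decomposition_homogeneous:
  "v \<in> weight a \<Longrightarrow> is_weight_decomposition v (\<lambda>h. if h = a then v else 0)"
  unfolding is_weight_decomposition_def
  by (auto simp: zero_weight intro: finite_subset[of _ "{a}"])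

lemma is_weight_decomposition_add:
  assumes "is_weight_decomposition u f" "is_weight_decomposition v g"
  shows "is_weight_decomposition (u + v) (\<lambda>h. f h + g h)"
  using assms unfolding is_weight_decomposition_def
  by (auto simp: weight_add Sum_any.distrib
      intro: finite_subset[of _ "{h. f h \<noteq> 0} \<union> {h. g h \<noteq> 0}"])

lemma is_weight_decomposition_scale:
  assumes "is_weight_decomposition v f"
  shows "is_weight_decomposition (scaleV c v) (\<lambda>h. scaleV c (f h))"
proof -
  have "scaleV c (Sum_any f) = Sum_any (\<lambda>h. scaleV c (f h))"
    by (rule additive_Sum_any)
       (use assms in \<open>auto simp: V.scale_right_distrib is_weight_decomposition_def\<close>)
  with assms show ?thesis
    unfolding is_weight_decomposition_def
    by (auto simp: weight_scale intro: finite_subset[of _ "{h. f h \<noteq> 0}"])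
qed

text \<open>The difference of two decompositions is a vanishing sum of
  \<open>L(0)\<close>-eigenvectors with distinct eigenvalues.\<close>

lemma is_weight_decomposition_unique:
  assumes f: "is_weight_decomposition v f" and g: "is_weight_decomposition v g"
  shows "f = g"
proof
  fix h
  define d where "d i = f i + scaleV (-1) (g i)" for i
  have "is_weight_decomposition (v + scaleV (-1) v) d"
    unfolding d_def by (intro is_weight_decomposition_add is_weight_decomposition_scale f g)
  then have d: "\<And>i. d i \<in> weight i" "finite {i. d i \<noteq> 0}" "Sum_any d = 0"
    by (auto simp: is_weight_decomposition_def)
  have "\<forall>i\<in>{i. d i \<noteq> 0}. d i = 0"
  proof (rule eigenvectors_sum_zero)
    show "vector_space scaleV" by unfold_locales
    show "L 0 (d i) = scaleV (of_int i) (d i)" for i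
      using d(1)[of i] by (simp add: L0_eigenspace_def)
    show "sum d {i. d i \<noteq> 0} = 0"
      using d(3) by (simp add: Sum_any.expand_set)
  qed (auto simp: virasoro_mode_def add_right scale_right d(2) inj_on_def)
  then have "d h = 0" by blast
  then show "f h = g h" by (simp add: d_def)
qed

text \<open>Existence by homogeneous induction, together with uniqueness, makes the description
  meaningful. Components are computed from here on by exhibiting a decomposition.\<close>

lemma is_weight_decomposition_iff:
  "is_weight_decomposition v f \<longleftrightarrow> f = weight_component scaleV Y \<omega> v"
proof -
  have "\<exists>f. is_weight_decomposition v f"
    by (induction v rule: homogeneous_induct)
       (blast intro: is_weight_decomposition_homogeneous is_weight_decomposition_add)+
  then have "\<exists>!f. is_weight_decomposition v f"
    using is_weight_decomposition_unique by blast
  moreover have "weight_component scaleV Y \<omega> v = (THE f. is_weight_decomposition v f)"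
    by (simp add: weight_component_def is_weight_decomposition_def)
  ultimately show ?thesis
    using theI'[of "is_weight_decomposition v"] is_weight_decomposition_unique by metis
qed

lemma weight_component_homogeneous:
  "v \<in> weight a \<Longrightarrow> weight_component scaleV Y \<omega> v = (\<lambda>h. if h = a then v else 0)"
  using is_weight_decomposition_homogeneous by (simp add: is_weight_decomposition_iff)

lemma weight_component_add:
  "weight_component scaleV Y \<omega> (u + v) h
    = weight_component scaleV Y \<omega> u h + weight_component scaleV Y \<omega> v h"
  using is_weight_decomposition_add[of u "weight_component scaleV Y \<omega> u" v "weight_component scaleV Y \<omega> v"]
  by (simp add: is_weight_decomposition_iff fun_eq_iff)

lemma weight_component_scale:
  "weight_component scaleV Y \<omega> (scaleV c v) h = scaleV c (weight_component scaleV Y \<omega> v h)"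
  using is_weight_decomposition_scale[of v "weight_component scaleV Y \<omega> v" c]
  by (simp add: is_weight_decomposition_iff fun_eq_iff)

lemma finite_weight_component: "finite {h. weight_component scaleV Y \<omega> v h \<noteq> 0}"
  using is_weight_decomposition_iff[of v "weight_component scaleV Y \<omega> v"]
  by (simp add: is_weight_decomposition_def)

lemma L1_div_zero [simp]: "L1_div p 0 = 0"
  using L1_div_scale[of p 0 0] by simp

lemma opposite_coeff_altdef:
  "opposite_coeff scaleV Y \<omega> v k = Sum_any (\<lambda>h. if k + 2 * h \<ge> 0
     then scaleV ((-1) powi h) (L1_div (nat (k + 2 * h)) (weight_component scaleV Y \<omega> v h)) else 0)"
  unfolding opposite_coeff_def L1_div_def by (simp cong: if_cong)

lemma opposite_coeff_homogeneous:
  assumes "v \<in> weight a"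
  shows "opposite_coeff scaleV Y \<omega> v k =
    (if k + 2 * a \<ge> 0 then scaleV ((-1) powi a) (L1_div (nat (k + 2 * a)) v) else 0)"
  unfolding opposite_coeff_altdef weight_component_homogeneous[OF assms]
  by (subst Sum_any_eq_single[of a]) auto

lemma opposite_coeff_add:
  "opposite_coeff scaleV Y \<omega> (u + v) k = opposite_coeff scaleV Y \<omega> u k + opposite_coeff scaleV Y \<omega> v k"
proof -
  define F where "F v h = (if k + 2 * h \<ge> 0
     then scaleV ((-1) powi h) (L1_div (nat (k + 2 * h)) (weight_component scaleV Y \<omega> v h)) else 0)" for v h
  have "finite {h. F v h \<noteq> 0}" for v
    by (rule finite_subset[OF _ finite_weight_component[of v]]) (auto simp: F_def)
  then have "Sum_any (\<lambda>h. F u h + F v h) = Sum_any (F u) + Sum_any (F v)"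
    by (intro Sum_any.distrib)
  moreover have "F (u + v) = (\<lambda>h. F u h + F v h)"
    by (auto simp: F_def weight_component_add L1_div_add V.scale_right_distrib)
  ultimately show ?thesis
    unfolding opposite_coeff_altdef F_def[symmetric] by simp
qed

lemma opposite_coeff_scale:
  "opposite_coeff scaleV Y \<omega> (scaleV c v) k = scaleV c (opposite_coeff scaleV Y \<omega> v k)"
proof -
  define F where "F v h = (if k + 2 * h \<ge> 0
     then scaleV ((-1) powi h) (L1_div (nat (k + 2 * h)) (weight_component scaleV Y \<omega> v h)) else 0)" for v h
  have "finite {h. F v h \<noteq> 0}"
    by (rule finite_subset[OF _ finite_weight_component[of v]]) (auto simp: F_def)
  then have "scaleV c (Sum_any (F v)) = Sum_any (\<lambda>h. scaleV c (F v h))"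
    by (intro additive_Sum_any) (simp_all add: V.scale_right_distrib)
  moreover have "F (scaleV c v) = (\<lambda>h. scaleV c (F v h))"
    by (auto simp: F_def weight_component_scale L1_div_scale mult.commute)
  ultimately show ?thesis
    unfolding opposite_coeff_altdef F_def[symmetric] by simp
qed

text \<open>For \<open>v\<close> of weight \<open>a\<close> the exponents are
  \<open>k = p - 2a\<close> with \<open>L1_div p v\<close> nonzero, hence finite in number.\<close>

lemma finite_opposite_coeff: "finite {k. opposite_coeff scaleV Y \<omega> v k \<noteq> 0}"
proof (induction v rule: homogeneous_induct)
  case (1 a v)
  obtain P where P: "\<And>p. p \<ge> P \<Longrightarrow> L1_div p v = 0"
    using L1_div_eventually_zero[of v] by (auto simp: eventually_sequentially)
  have "{k. opposite_coeff scaleV Y \<omega> v k \<noteq> 0} \<subseteq> {- 2 * a..int P - 2 * a}"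
  proof
    fix k assume "k \<in> {k. opposite_coeff scaleV Y \<omega> v k \<noteq> 0}"
    then have "k + 2 * a \<ge> 0" "\<not> P \<le> nat (k + 2 * a)"
      using P by (auto simp: opposite_coeff_homogeneous[OF 1] split: if_splits)
    then show "k \<in> {- 2 * a..int P - 2 * a}" by auto
  qed
  then show ?case by (rule finite_subset) simp
next
  case (2 u v)
  then show ?case
    by (rule finite_subset[OF _ finite_UnI, rotated]) (auto simp: opposite_coeff_add)
qed

end

section \<open>Opposite modes on a weak module\<close>

locale voa_weak_module =
  vertex_operator_algebra scaleV Y vac \<omega> + W: weak_module scaleV Y vac scaleW UNIV YW
  for scaleV :: "complex \<Rightarrow> 'v::ab_group_add \<Rightarrow> 'v"
    and Y :: "'v \<Rightarrow> int \<Rightarrow> 'v \<Rightarrow> 'v"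
    and vac \<omega> :: 'v
    and scaleW :: "complex \<Rightarrow> 'w::ab_group_add \<Rightarrow> 'w"
    and YW :: "'v \<Rightarrow> int \<Rightarrow> 'w \<Rightarrow> 'w"
begin

text \<open>The operator on \<open>W\<close> whose transpose is the mode
  \<open>v\<^sup>*\<^sub>n\<close>. Identities are proved for it on vectors and carried over to
  functionals afterwards.\<close>

definition opposite_mode :: "'v \<Rightarrow> int \<Rightarrow> 'w \<Rightarrow> 'w" where
  "opposite_mode v n w = Sum_any (\<lambda>k. YW (opposite_coeff scaleV Y \<omega> v k) (- n - k - 2) w)"

lemma finite_opposite_mode:
  "finite {k. YW (opposite_coeff scaleV Y \<omega> v k) (- n - k - 2) w \<noteq> 0}"
  by (rule finite_subset[OF _ finite_opposite_coeff[of v]]) (auto simp: W.zero_left)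

lemma opposite_mode_add_left:
  "opposite_mode (u + v) n w = opposite_mode u n w + opposite_mode v n w"
  unfolding opposite_mode_def
  by (simp add: opposite_coeff_add W.add_left Sum_any.distrib finite_opposite_mode)

lemma opposite_mode_scale_left:
  "opposite_mode (scaleV c v) n w = scaleW c (opposite_mode v n w)"
  unfolding opposite_mode_def
  by (subst additive_Sum_any)
     (simp_all add: opposite_coeff_scale W.scale_left W.M.scale_right_distrib finite_opposite_mode)

lemma opposite_mode_add_right:
  "opposite_mode v n (w + w') = opposite_mode v n w + opposite_mode v n w'"
  unfolding opposite_mode_def
  by (simp add: W.add_right Sum_any.distrib finite_opposite_mode)

lemma opposite_mode_scale_right:
  "opposite_mode v n (scaleW c w) = scaleW c (opposite_mode v n w)"
  unfolding opposite_mode_def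
  by (subst additive_Sum_any)
     (simp_all add: W.scale_right W.M.scale_right_distrib finite_opposite_mode)

lemma opposite_mode_zero_left [simp]: "opposite_mode 0 n w = 0"
  using opposite_mode_scale_left[of 0 0] by simp

lemma opposite_mode_zero_right [simp]: "opposite_mode v n 0 = 0"
  using opposite_mode_scale_right[of v n 0 0] by simp

text \<open>Substituting \<open>k = p - 2a\<close> turns the mode \<open>-n-k-2\<close> into
  \<open>2a-2-n-p\<close>. Any bound \<open>P\<close> past the last nonzero divided power may be
  used, so one bound can serve several modes.\<close>

lemma opposite_mode_homogeneous:
  assumes v: "v \<in> weight a" and P: "\<And>p. p \<ge> P \<Longrightarrow> L1_div p v = 0"
  shows "opposite_mode v n w
    = scaleW ((-1) powi a) (\<Sum>p<P. YW (L1_div p v) (2 * a - 2 - n - int p) w)"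
proof -
  have "opposite_mode v n w
      = (\<Sum>k\<in>{- 2 * a..<int P - 2 * a}. YW (opposite_coeff scaleV Y \<omega> v k) (- n - k - 2) w)"
    unfolding opposite_mode_def
  proof (rule Sum_any.expand_superset)
    show "{k. YW (opposite_coeff scaleV Y \<omega> v k) (- n - k - 2) w \<noteq> 0} \<subseteq> {- 2 * a..<int P - 2 * a}"
    proof
      fix k assume "k \<in> {k. YW (opposite_coeff scaleV Y \<omega> v k) (- n - k - 2) w \<noteq> 0}"
      then have "k + 2 * a \<ge> 0" "\<not> P \<le> nat (k + 2 * a)"
        using P by (auto simp: opposite_coeff_homogeneous[OF v] W.zero_left split: if_splits)
      then show "k \<in> {- 2 * a..<int P - 2 * a}" by auto
    qed
  qed simp
  also have "\<dots> = (\<Sum>p<P. scaleW ((-1) powi a) (YW (L1_div p v) (2 * a - 2 - n - int p) w))"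
    by (rule sum.reindex_bij_witness[symmetric,
          where i = "\<lambda>k. nat (k + 2 * a)" and j = "\<lambda>p. int p - 2 * a"])
       (auto simp: opposite_coeff_homogeneous[OF v] W.scale_left algebra_simps)
  finally show ?thesis by (simp add: W.M.scale_sum_right)
qed

text \<open>The index enters with a minus sign, so truncation on \<open>W\<close> kills opposite
  modes of very negative index. For large positive index, vanishing comes only after pairing with a
  functional in \<open>D\<close>.\<close>

lemma opposite_mode_eventually_zero:
  "\<forall>\<^sub>F i in sequentially. opposite_mode v (c - int i) w = 0"
proof (induction v rule: homogeneous_induct)
  case (1 a v)
  obtain P where P: "\<And>p. p \<ge> P \<Longrightarrow> L1_div p v = 0"
    using L1_div_eventually_zero[of v] by (auto simp: eventually_sequentially)
  have "\<forall>\<^sub>F i in sequentially. \<forall>p\<in>{..<P}. YW (L1_div p v) (2 * a - 2 - c - int p + int i) w = 0"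
    by (intro eventually_ball_finite ballI W.eventually_mode_zero) simp_all
  then show ?case
    by eventually_elim (simp add: opposite_mode_homogeneous[OF 1 P] algebra_simps)
next
  case (2 u v)
  then show ?case by eventually_elim (simp add: opposite_mode_add_left)
qed

text \<open>Expanding \<open>L(1)^N (u\<^sub>l\<^sub>+\<^sub>i v)\<close> by
  \<open>L1_div_mode\<close> and collecting terms with equal \<open>s = i + r\<close>, the
  alternating convolution produces exactly the binomial coefficients of the right-hand sides of the
  Jacobi identities on \<open>W\<close> for the pairs \<open>L1_div j u\<close>,
  \<open>L1_div p v\<close>.\<close>

lemma opposite_mode_iterate_homogeneous:
  assumes u: "u \<in> weight a" and v: "v \<in> weight b"
    and J: "\<And>j. j \<ge> J \<Longrightarrow> L1_div j u = 0" and P: "\<And>p. p \<ge> P \<Longrightarrow> L1_div p v = 0"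
    and K: "\<And>j p s. s \<ge> K \<Longrightarrow> Y (L1_div j u) (l + int s) (L1_div p v) = 0"
  shows "Sum_any (\<lambda>i. scaleW (of_int m gchoose i) (opposite_mode (Y u (l + int i) v) (m + n - int i) w))
    = scaleW ((-1) powi (a + b - l - 1)) (\<Sum>j<J. \<Sum>p<P. \<Sum>s<K.
        scaleW (of_int (2 * a - 2 - int j - l - m) gchoose s)
          (YW (Y (L1_div j u) (l + int s) (L1_div p v))
            (2 * a - 2 - int j - l - m + (2 * b - 2 - int p - l - n) - int s) w))"
proof -
  define E where "E j p s = YW (Y (L1_div j u) (l + int s) (L1_div p v))
      (2 * a - 2 - int j - l - m + (2 * b - 2 - int p - l - n) - int s) w" for j p s
  define X :: "nat \<Rightarrow> complex" where "X j = of_int (2 * a - 2 - int j - l)" for j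
  define \<kappa> :: complex where "\<kappa> = (-1) powi (a + b - l - 1)"
  have E0: "E j p s = 0" if "j \<ge> J \<or> s \<ge> K \<or> p \<ge> P" for j p s
    using that J P K[of s j p] by (auto simp: E_def W.zero_left zero_left zero_right)
  have mode: "opposite_mode (Y u (l + int i) v) (m + n - int i) w = scaleW (\<kappa> * (-1) ^ i)
      (\<Sum>j<J. \<Sum>p<P. \<Sum>r<K. scaleW (X j - of_nat i gchoose r) (E j p (i + r)))" for i
  proof -
    \<comment> \<open>The weight of \<open>u\<^sub>l\<^sub>+\<^sub>i v\<close>.\<close>
    define c where "c = a + b - (l + int i) - 1"
    have c: "Y u (l + int i) v \<in> weight c"
      using mode_weight[OF weak_module_axioms u, of v "of_int b" "l + int i"] v
      by (simp add: c_def algebra_simps)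
    have D: "L1_div N (Y u (l + int i) v) = (\<Sum>(j, r, p)\<in>triples N.
        scaleV (X j - of_nat i gchoose r) (Y (L1_div j u) (l + int (i + r)) (L1_div p v)))" for N
      unfolding L1_div_mode[OF u] by (rule sum.cong) (auto simp: X_def algebra_simps)
    have D0: "L1_div N (Y u (l + int i) v) = 0" if "N \<ge> J + K + P" for N
      unfolding D
    proof (rule sum.neutral, clarify)
      fix j r p assume "(j, r, p) \<in> triples N"
      then have "j \<ge> J \<or> r \<ge> K \<or> p \<ge> P" using that by (auto simp: triples_def)
      then show "scaleV (X j - of_nat i gchoose r) (Y (L1_div j u) (l + int (i + r)) (L1_div p v)) = 0"
        using J P K[of "i + r" j p] by (auto simp: zero_left zero_right)
    qed
    have "opposite_mode (Y u (l + int i) v) (m + n - int i) w = scaleW ((-1) powi c)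
        (\<Sum>N<J + K + P. YW (L1_div N (Y u (l + int i) v)) (2 * c - 2 - (m + n - int i) - int N) w)"
      by (rule opposite_mode_homogeneous[OF c D0])
    also have "(\<Sum>N<J + K + P. YW (L1_div N (Y u (l + int i) v)) (2 * c - 2 - (m + n - int i) - int N) w)
        = (\<Sum>N<J + K + P. \<Sum>(j, r, p)\<in>triples N. scaleW (X j - of_nat i gchoose r) (E j p (i + r)))"
    proof (rule sum.cong[OF refl])
      fix N
      \<comment> \<open>With \<open>N = j + r + p\<close> and the value of \<open>c\<close>, the
        mode index depends on \<open>i\<close> and \<open>r\<close> through \<open>i + r\<close>
        only, which is why \<open>E\<close> has a single third argument.\<close>
      show "YW (L1_div N (Y u (l + int i) v)) (2 * c - 2 - (m + n - int i) - int N) w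
          = (\<Sum>(j, r, p)\<in>triples N. scaleW (X j - of_nat i gchoose r) (E j p (i + r)))"
        unfolding D W.sum_left[OF UNIV_I]
        by (rule sum.cong)
           (auto simp: W.scale_left E_def c_def triples_def algebra_simps)
    qed
    also have "\<dots> = (\<Sum>j<J. \<Sum>p<P. \<Sum>r<K. scaleW (X j - of_nat i gchoose r) (E j p (i + r)))"
      by (rule sum_triples_box) (auto simp: E0)
    also have "(-1 :: complex) powi c = \<kappa> * (-1) ^ i"
    proof -
      have "c = (a + b - l - 1) + - int i" by (simp add: c_def)
      then have "(-1 :: complex) powi c = \<kappa> * (-1) powi (- int i)"
        by (simp only: \<kappa>_def) (subst power_int_add, simp_all)
      then show ?thesis by (simp add: power_int_minus flip: power_inverse)
    qed
    finally show ?thesis .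
  qed
  \<comment> \<open>\<open>L1_div 0\<close> is the identity, so the bound \<open>K\<close> covers
    the products of \<open>u\<close> and \<open>v\<close> themselves.\<close>
  have "Y u (l + int i) v = 0" if "i \<ge> K" for i
    using K[of i 0 0] that by simp
  then have "Sum_any (\<lambda>i. scaleW (of_int m gchoose i) (opposite_mode (Y u (l + int i) v) (m + n - int i) w))
      = (\<Sum>i<K. scaleW (of_int m gchoose i) (opposite_mode (Y u (l + int i) v) (m + n - int i) w))"
    by (intro Sum_any_eq_sum_lessThan) simp
  also have "\<dots> = (\<Sum>i<K. \<Sum>j<J. \<Sum>p<P. \<Sum>r<K.
      scaleW (\<kappa> * ((-1) ^ i * (of_int m gchoose i) * (X j - of_nat i gchoose r))) (E j p (i + r)))"
    by (simp add: mode W.M.scale_sum_right mult_ac)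
  also have "\<dots> = (\<Sum>j<J. \<Sum>p<P. \<Sum>i<K. \<Sum>r<K.
      scaleW (\<kappa> * ((-1) ^ i * (of_int m gchoose i) * (X j - of_nat i gchoose r))) (E j p (i + r)))"
    by (subst sum.swap, rule sum.cong[OF refl], rule sum.swap)
  \<comment> \<open>Now \<open>s = i + r\<close>; the inner sum over \<open>i\<close> is the
    alternating convolution.\<close>
  also have "\<dots> = (\<Sum>j<J. \<Sum>p<P. \<Sum>s<K. \<Sum>i\<le>s.
      scaleW (\<kappa> * ((-1) ^ i * (of_int m gchoose i) * (X j - of_nat i gchoose (s - i)))) (E j p s))"
    by (simp add: sum_square_eq_sum_diagonals E0)
  also have "\<dots> = (\<Sum>j<J. \<Sum>p<P. \<Sum>s<K. scaleW (\<kappa> * (X j - of_int m gchoose s)) (E j p s))"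
    by (simp only: gbinomial_alternating_convolution flip: W.M.scale_sum_left sum_distrib_left)
  finally show ?thesis
    by (simp add: W.M.scale_sum_right \<kappa>_def X_def E_def)
qed


section \<open>The Jacobi identity for opposite modes\<close>

text \<open>Each composite is a double sum over \<open>j\<close> and \<open>p\<close> of composites
  on \<open>W\<close>. Since the order of composition is reversed, the first sum here matches the
  second sum of the Jacobi identities on \<open>W\<close> and conversely; the sign
  \<open>(-1)^(a+b-l-1)\<close> makes up for this interchange.\<close>

lemma opposite_mode_jacobi_homogeneous:
  assumes u: "u \<in> weight a" and v: "v \<in> weight b"
  shows "Sum_any (\<lambda>i. scaleW ((-1) ^ i * (of_int l gchoose i))
                   (opposite_mode v (n + int i) (opposite_mode u (m + l - int i) w)))
    - Sum_any (\<lambda>i. scaleW ((-1) powi l * (-1) ^ i * (of_int l gchoose i))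
                   (opposite_mode u (m + int i) (opposite_mode v (n + l - int i) w)))
    = Sum_any (\<lambda>i. scaleW (of_int m gchoose i) (opposite_mode (Y u (l + int i) v) (m + n - int i) w))"
proof -
  obtain J where J: "\<And>j. j \<ge> J \<Longrightarrow> L1_div j u = 0"
    using L1_div_eventually_zero[of u] by (auto simp: eventually_sequentially)
  obtain P where P: "\<And>p. p \<ge> P \<Longrightarrow> L1_div p v = 0"
    using L1_div_eventually_zero[of v] by (auto simp: eventually_sequentially)
  \<comment> \<open>Chosen so that mode \<open>m + l - i\<close> of the opposite of \<open>u\<close>
    contributes modes \<open>m' j + i\<close> on \<open>W\<close>, and mode \<open>n + i\<close> of
    the opposite of \<open>v\<close> contributes \<open>n' p + l - i\<close>: the index patterns of
    the Jacobi identity.\<close>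
  define m' where "m' j = 2 * a - 2 - int j - l - m" for j
  define n' where "n' p = 2 * b - 2 - int p - l - n" for p
  have "\<forall>\<^sub>F i in sequentially. \<forall>(j, p)\<in>{..<J} \<times> {..<P}.
      YW (L1_div j u) (m' j + int i) w = 0 \<and> YW (L1_div p v) (n' p + int i) w = 0
      \<and> Y (L1_div j u) (l + int i) (L1_div p v) = 0"
    by (intro eventually_ball_finite ballI, simp)
       (auto intro!: eventually_conj W.eventually_mode_zero eventually_mode_zero)
  then obtain K where K: "\<And>i j p. i \<ge> K \<Longrightarrow> j < J \<Longrightarrow> p < P \<Longrightarrow>
      YW (L1_div j u) (m' j + int i) w = 0 \<and> YW (L1_div p v) (n' p + int i) w = 0
      \<and> Y (L1_div j u) (l + int i) (L1_div p v) = 0"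
    by (auto simp: eventually_sequentially)
  \<comment> \<open>Outside the finite box of \<open>j\<close> and \<open>p\<close> a divided power
    vanishes, so the same \<open>K\<close> works for all \<open>j\<close> and
    \<open>p\<close>.\<close>
  have K3: "Y (L1_div j u) (l + int i) (L1_div p v) = 0" if "i \<ge> K" for i j p
    using K[OF that, of j p] J[of j] P[of p]
    by (cases "j < J"; cases "p < P") (auto simp: zero_left zero_right)
  define \<epsilon> :: complex where "\<epsilon> = (-1) powi (a + b)"
  define c :: "nat \<Rightarrow> complex" where "c i = (-1) ^ i * (of_int l gchoose i)" for i
  define A where "A j p i = YW (L1_div p v) (n' p + l - int i) (YW (L1_div j u) (m' j + int i) w)" for j p i
  define B where "B j p i = YW (L1_div j u) (m' j + l - int i) (YW (L1_div p v) (n' p + int i) w)" for j p i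
  have \<epsilon>: "(-1) powi a * (-1) powi b = \<epsilon>" "(-1) powi b * (-1) powi a = \<epsilon>"
    by (simp_all add: \<epsilon>_def power_int_add)
  have opp_u: "opposite_mode u k x
      = scaleW ((-1) powi a) (\<Sum>j<J. YW (L1_div j u) (2 * a - 2 - k - int j) x)" for k x
    by (rule opposite_mode_homogeneous[OF u]) (rule J)
  have opp_v: "opposite_mode v k x
      = scaleW ((-1) powi b) (\<Sum>p<P. YW (L1_div p v) (2 * b - 2 - k - int p) x)" for k x
    by (rule opposite_mode_homogeneous[OF v]) (rule P)
  have A: "opposite_mode v (n + int i) (opposite_mode u (m + l - int i) w)
      = scaleW \<epsilon> (\<Sum>j<J. \<Sum>p<P. A j p i)" for i
  proof -
    have idx: "2 * a - 2 - (m + l - int i) - int j = m' j + int i"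
      "2 * b - 2 - (n + int i) - int p = n' p + l - int i" for j p
      by (simp_all add: m'_def n'_def)
    show ?thesis
      unfolding opp_u opp_v idx A_def
      by (subst sum.swap)
         (simp add: W.scale_right W.sum_right \<epsilon> flip: W.M.scale_sum_right)
  qed
  have B: "opposite_mode u (m + int i) (opposite_mode v (n + l - int i) w)
      = scaleW \<epsilon> (\<Sum>j<J. \<Sum>p<P. B j p i)" for i
  proof -
    have idx: "2 * a - 2 - (m + int i) - int j = m' j + l - int i"
      "2 * b - 2 - (n + l - int i) - int p = n' p + int i" for j p
      by (simp_all add: m'_def n'_def)
    show ?thesis
      unfolding opp_u opp_v idx B_def
      by (simp add: W.scale_right W.sum_right \<epsilon> flip: W.M.scale_sum_right)
  qed
  have A0: "A j p i = 0" and B0: "B j p i = 0" if "i \<ge> K" "j < J" "p < P" for i j p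
    using K[OF that] by (simp_all add: A_def B_def W.zero_right)
  have jac: "(\<Sum>i<K. scaleW (c i) (B j p i)) - (\<Sum>i<K. scaleW ((-1) powi l * c i) (A j p i))
      = (\<Sum>i<K. scaleW (of_int (m' j) gchoose i)
          (YW (Y (L1_div j u) (l + int i) (L1_div p v)) (m' j + n' p - int i) w))"
    if "j < J" "p < P" for j p
    using W.jacobi[OF UNIV_I, of l "L1_div j u" "m' j" "L1_div p v" "n' p" w]
    by (subst (asm) (1 2 3) Sum_any_eq_sum_lessThan[of K])
       (use that A0 B0 K3 in \<open>auto simp: A_def B_def c_def mult.assoc W.zero_left\<close>)
  have "Sum_any (\<lambda>i. scaleW (c i) (opposite_mode v (n + int i) (opposite_mode u (m + l - int i) w)))
      - Sum_any (\<lambda>i. scaleW ((-1) powi l * c i)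
          (opposite_mode u (m + int i) (opposite_mode v (n + l - int i) w)))
      = (\<Sum>i<K. scaleW (c i) (scaleW \<epsilon> (\<Sum>j<J. \<Sum>p<P. A j p i)))
      - (\<Sum>i<K. scaleW ((-1) powi l * c i) (scaleW \<epsilon> (\<Sum>j<J. \<Sum>p<P. B j p i)))"
    unfolding A B
    by (subst (1 2) Sum_any_eq_sum_lessThan[of K]) (simp_all add: A0 B0)
  also have "(\<Sum>i<K. scaleW (c i) (scaleW \<epsilon> (\<Sum>j<J. \<Sum>p<P. A j p i)))
      = scaleW \<epsilon> (\<Sum>j<J. \<Sum>p<P. \<Sum>i<K. scaleW (c i) (A j p i))"
    by (simp only: W.M.scale_sum_right W.M.scale_left_commute[of _ \<epsilon>])
       (subst sum.swap, rule sum.cong[OF refl], rule sum.swap)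
  also have "(\<Sum>i<K. scaleW ((-1) powi l * c i) (scaleW \<epsilon> (\<Sum>j<J. \<Sum>p<P. B j p i)))
      = scaleW \<epsilon> (\<Sum>j<J. \<Sum>p<P. \<Sum>i<K. scaleW ((-1) powi l * c i) (B j p i))"
    by (simp only: W.M.scale_sum_right W.M.scale_left_commute[of _ \<epsilon>])
       (subst sum.swap, rule sum.cong[OF refl], rule sum.swap)
  also have "scaleW \<epsilon> (\<Sum>j<J. \<Sum>p<P. \<Sum>i<K. scaleW (c i) (A j p i))
      - scaleW \<epsilon> (\<Sum>j<J. \<Sum>p<P. \<Sum>i<K. scaleW ((-1) powi l * c i) (B j p i))
      = scaleW ((-1) powi (a + b - l - 1)) (\<Sum>j<J. \<Sum>p<P.
          (\<Sum>i<K. scaleW (c i) (B j p i)) - (\<Sum>i<K. scaleW ((-1) powi l * c i) (A j p i)))"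
  proof -
    \<comment> \<open>As \<open>\<sigma>\<close> is its own inverse, factoring out
      \<open>-\<epsilon>\<sigma>\<close> moves the factor \<open>(-1)^l\<close> from the
      \<open>B\<close> sum to the \<open>A\<close> sum and exchanges their signs.\<close>
    define \<sigma> :: complex where "\<sigma> = (-1) powi l"
    have l: "\<sigma> * \<sigma> = 1"
      by (simp add: \<sigma>_def flip: power_int_mult_distrib)
    have "(-1 :: complex) powi (a + b - l - 1) = \<epsilon> / \<sigma> / (-1)"
      unfolding \<epsilon>_def \<sigma>_def by (subst power_int_diff, simp)+ simp
    then have "(-1 :: complex) powi (a + b - l - 1) = - (\<epsilon> * \<sigma>)"
      by (simp add: divide_inverse inverse_unique[OF l])
    moreover have "scaleW \<sigma> (scaleW \<sigma> x) = x" for x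
      by (simp add: l)
    ultimately show ?thesis
      unfolding \<sigma>_def[symmetric]
      by (simp add: sum_subtractf sum_negf W.M.scale_right_diff_distrib W.M.scale_sum_right
            flip: W.M.scale_scale)
  qed
  also have "(\<Sum>j<J. \<Sum>p<P.
          (\<Sum>i<K. scaleW (c i) (B j p i)) - (\<Sum>i<K. scaleW ((-1) powi l * c i) (A j p i)))
      = (\<Sum>j<J. \<Sum>p<P. \<Sum>i<K. scaleW (of_int (m' j) gchoose i)
          (YW (Y (L1_div j u) (l + int i) (L1_div p v)) (m' j + n' p - int i) w))"
    by (simp add: jac)
  also have "scaleW ((-1) powi (a + b - l - 1)) \<dots> = Sum_any (\<lambda>i. scaleW (of_int m gchoose i)
      (opposite_mode (Y u (l + int i) v) (m + n - int i) w))"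
    unfolding m'_def n'_def
    by (rule opposite_mode_iterate_homogeneous[symmetric, OF u v]) (fact J P K3)+
  finally show ?thesis
    by (simp only: c_def mult.assoc)
qed


lemma finite_opposite_mode_composite:
  "finite {i. scaleW (c i) (opposite_mode v (k i) (opposite_mode u (d - int i) w)) \<noteq> 0}"
  by (rule finite_support_if_eventually_zero, rule eventually_mono[OF opposite_mode_eventually_zero[of u d w]]) simp

lemma finite_opposite_mode_iterate:
  "finite {i. scaleW (c i) (opposite_mode (Y u (d + int i) v) (k i) w) \<noteq> 0}"
  by (rule finite_support_if_eventually_zero, rule eventually_mono[OF eventually_mode_zero[OF UNIV_I, of u d v]]) simp

text \<open>At a fixed \<open>w\<close> all three sums have finite support, hence are additive in
  \<open>u\<close> and in \<open>v\<close>; two nested homogeneous inductions reduce to homogeneous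
  vectors.\<close>

lemma opposite_mode_jacobi:
  "Sum_any (\<lambda>i. scaleW ((-1) ^ i * (of_int l gchoose i))
                   (opposite_mode v (n + int i) (opposite_mode u (m + l - int i) w)))
    - Sum_any (\<lambda>i. scaleW ((-1) powi l * (-1) ^ i * (of_int l gchoose i))
                   (opposite_mode u (m + int i) (opposite_mode v (n + l - int i) w)))
    = Sum_any (\<lambda>i. scaleW (of_int m gchoose i) (opposite_mode (Y u (l + int i) v) (m + n - int i) w))"
proof -
  define F where "F u v i = scaleW ((-1) ^ i * (of_int l gchoose i))
      (opposite_mode v (n + int i) (opposite_mode u (m + l - int i) w))" for u v i
  define G where "G u v i = scaleW ((-1) powi l * (-1) ^ i * (of_int l gchoose i))
      (opposite_mode u (m + int i) (opposite_mode v (n + l - int i) w))" for u v i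
  define H where "H u v i = scaleW (of_int m gchoose i)
      (opposite_mode (Y u (l + int i) v) (m + n - int i) w)" for u v i
  have fin: "finite {i. F u v i \<noteq> 0}" "finite {i. G u v i \<noteq> 0}" "finite {i. H u v i \<noteq> 0}" for u v
    unfolding F_def G_def H_def
    by (rule finite_opposite_mode_composite finite_opposite_mode_iterate)+
  have add1: "F (u + u') v = (\<lambda>i. F u v i + F u' v i)" "G (u + u') v = (\<lambda>i. G u v i + G u' v i)"
    "H (u + u') v = (\<lambda>i. H u v i + H u' v i)" for u u' v
    by (simp_all add: fun_eq_iff F_def G_def H_def opposite_mode_add_left opposite_mode_add_right
        add_left W.M.scale_right_distrib)
  have add2: "F u (v + v') = (\<lambda>i. F u v i + F u v' i)" "G u (v + v') = (\<lambda>i. G u v i + G u v' i)"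
    "H u (v + v') = (\<lambda>i. H u v i + H u v' i)" for u v v'
    by (simp_all add: fun_eq_iff F_def G_def H_def opposite_mode_add_left opposite_mode_add_right
        add_right W.M.scale_right_distrib)
  have "Sum_any (F u v) - Sum_any (G u v) = Sum_any (H u v)"
  proof (induction u rule: homogeneous_induct)
    case (1 a u)
    show ?case
    proof (induction v rule: homogeneous_induct)
      case (1 b v)
      then show ?case
        unfolding F_def G_def H_def
        by (rule opposite_mode_jacobi_homogeneous[OF \<open>u \<in> weight a\<close>])
    next
      case (2 v v')
      then show ?case
        unfolding add2 by (simp add: Sum_any.distrib fin add_diff_add)
    qed
  next
    case (2 u u')
    then show ?case
      unfolding add1 by (simp add: Sum_any.distrib fin add_diff_add)
  qed
  then show ?thesis by (simp only: F_def[abs_def] G_def[abs_def] H_def[abs_def])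
qed

text \<open>For a quasi-primary vector only the term \<open>p = 0\<close> survives. This applies to
  \<open>vac\<close> and \<open>\<omega>\<close>; for \<open>\<omega>\<close> the index 1 is fixed
  by \<open>n \<mapsto> 2 - n\<close>, so \<open>L(0)\<close> on functionals is the transpose of
  \<open>L(0)\<close> on \<open>W\<close>.\<close>

lemma opposite_mode_L1_zero:
  assumes "v \<in> weight a" "L 1 v = 0"
  shows "opposite_mode v n w = scaleW ((-1) powi a) (YW v (2 * a - 2 - n) w)"
  using opposite_mode_homogeneous[OF assms(1), of 1] L1_div_eq_0[OF assms(2)] by simp

lemma opposite_mode_vacuum: "opposite_mode vac n w = (if n = -1 then w else 0)"
  using opposite_mode_L1_zero[OF vacuum_weight L1_vacuum] by (auto simp: W.vacuum)

lemma opposite_mode_conformal: "opposite_mode \<omega> n w = YW \<omega> (2 - n) w"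
  using opposite_mode_L1_zero[OF conformal_vector_weight L1_conformal_vector] by simp

section \<open>The weak module structure on \<open>D(W)\<close>\<close>

lemma full_dual_iff: "\<alpha> \<in> full_dual scaleW \<longleftrightarrow>
    (\<forall>x y. \<alpha> (x + y) = \<alpha> x + \<alpha> y) \<and> (\<forall>c x. \<alpha> (scaleW c x) = c * \<alpha> x)"
proof -
  have "vector_space ((*) :: complex \<Rightarrow> _)"
    by unfold_locales (auto simp: algebra_simps)
  then show ?thesis
    by (auto simp: full_dual_def Vector_Spaces.linear_iff W.M.vector_space_axioms)
qed

lemma full_dual_zero: "\<alpha> \<in> full_dual scaleW \<Longrightarrow> \<alpha> 0 = 0"
  using W.M.scale_zero_left[of 0] by (metis full_dual_iff mult_zero_left)

lemma full_dual_Sum_any: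
  "\<alpha> \<in> full_dual scaleW \<Longrightarrow> finite {i. g i \<noteq> 0} \<Longrightarrow> \<alpha> (Sum_any g) = Sum_any (\<lambda>i. \<alpha> (g i))"
  by (intro additive_Sum_any) (auto simp: full_dual_zero full_dual_iff)

lemma dual_mode_eq:
  assumes "\<alpha> \<in> full_dual scaleW"
  shows "dual_mode scaleV Y \<omega> YW v n \<alpha> = (\<lambda>w. \<alpha> (opposite_mode v n w))"
  unfolding dual_mode_def opposite_mode_def full_dual_Sum_any[OF assms finite_opposite_mode] ..

abbreviation D :: "('w \<Rightarrow> complex) set" where
  "D \<equiv> D_space scaleV Y \<omega> scaleW YW"

lemma D_iff: "\<alpha> \<in> D \<longleftrightarrow> \<alpha> \<in> full_dual scaleW
    \<and> (\<forall>v. \<forall>\<^sub>F n in at_top. \<forall>w. \<alpha> (opposite_mode v n w) = 0)"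
  by (auto simp: D_space_def dual_mode_eq eventually_at_top_linorder fun_eq_iff)

lemma D_mode_shift:
  assumes "\<alpha> \<in> D"
  shows "\<forall>\<^sub>F m in at_top. \<forall>w. \<alpha> (opposite_mode v (m + c) w) = 0"
proof -
  obtain N where "\<And>n w. n \<ge> N \<Longrightarrow> \<alpha> (opposite_mode v n w) = 0"
    using assms by (fastforce simp: D_iff eventually_at_top_linorder)
  then show ?thesis
    by (intro eventually_at_top_linorderI[of "N - c"]) auto
qed

lemma D_mode_nat_shift:
  assumes "\<alpha> \<in> D"
  shows "\<forall>\<^sub>F i in sequentially. \<forall>w. \<alpha> (opposite_mode v (c + int i) w) = 0"
  using eventually_compose_filterlim[OF D_mode_shift[OF assms, of v c] filterlim_int_sequentially]
  by (simp add: add.commute)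

lemma dual_mode_full_dual:
  assumes "\<alpha> \<in> full_dual scaleW"
  shows "(\<lambda>w. \<alpha> (opposite_mode v n w)) \<in> full_dual scaleW"
  using assms by (simp add: full_dual_iff opposite_mode_add_right opposite_mode_scale_right)

text \<open>By the Jacobi identity with \<open>l = 0\<close>, exchanging the opposite modes of
  \<open>v\<close> and \<open>u\<close> costs terms in the opposite modes of \<open>Y u i v\<close>.
  Only finitely many \<open>i\<close> occur, independently of \<open>m\<close> and \<open>w\<close>,
  so for large \<open>m\<close> the functional \<alpha> kills every term, uniformly in
  \<open>w\<close>.\<close>

lemma D_closed:
  assumes "\<alpha> \<in> D"
  shows "(\<lambda>w. \<alpha> (opposite_mode v n w)) \<in> D"
  unfolding D_iff
proof (intro conjI allI)
  have \<alpha>: "\<alpha> \<in> full_dual scaleW" using assms by (simp add: D_iff)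
  then show "(\<lambda>w. \<alpha> (opposite_mode v n w)) \<in> full_dual scaleW"
    by (rule dual_mode_full_dual)
  fix u
  obtain K where K: "\<And>i. i \<ge> K \<Longrightarrow> Y u (int i) v = 0"
    using eventually_mode_zero[of v u 0] by (auto simp: eventually_sequentially)
  have "\<forall>\<^sub>F m in at_top. \<forall>i\<in>{..<K}. \<forall>w. \<alpha> (opposite_mode (Y u (int i) v) (m + (n - int i)) w) = 0"
    by (intro eventually_ball_finite ballI D_mode_shift assms) simp
  moreover have "\<forall>\<^sub>F m in at_top. \<forall>w. \<alpha> (opposite_mode u m w) = 0"
    using assms by (simp add: D_iff)
  ultimately show "\<forall>\<^sub>F m in at_top. \<forall>w. \<alpha> (opposite_mode v n (opposite_mode u m w)) = 0"
  proof eventually_elim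
    case (elim m)
    have "\<alpha> (opposite_mode v n (opposite_mode u m w)) = 0" for w
    proof -
      have "opposite_mode v n (opposite_mode u m w) = opposite_mode u m (opposite_mode v n w)
        + Sum_any (\<lambda>i. scaleW (of_int m gchoose i) (opposite_mode (Y u (int i) v) (m + n - int i) w))"
        using opposite_mode_jacobi[of 0 v n u m w]
        by (subst (asm) (1 2) Sum_any_eq_single[of 0])
           (auto simp: gbinomial_0_left algebra_simps)
      moreover have "\<alpha> (Sum_any (\<lambda>i. scaleW (of_int m gchoose i)
          (opposite_mode (Y u (int i) v) (m + n - int i) w))) = 0"
      proof -
        have "\<alpha> (opposite_mode (Y u (int i) v) (m + n - int i) w) = 0" for i
          using elim(1) K[of i] full_dual_zero[OF \<alpha>] by (cases "i < K") (auto simp: algebra_simps)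
        then show ?thesis
          using \<alpha> finite_opposite_mode_iterate[of "\<lambda>i. of_int m gchoose i" u 0 v]
          by (subst full_dual_Sum_any) (auto simp: full_dual_iff)
      qed
      ultimately show ?thesis
        using elim(2) \<alpha> by (simp add: full_dual_iff)
    qed
    then show ?case by blast
  qed
qed

text \<open>The support has to be finite in the function space: with a bound depending on
  \<open>w\<close>, the left-hand \<open>Sum_any\<close> could take its default value 0.\<close>

lemma Sum_any_fun_apply:
  fixes g :: "nat \<Rightarrow> 'w \<Rightarrow> complex"
  assumes "\<forall>\<^sub>F i in sequentially. g i = 0"
  shows "Sum_any g w = Sum_any (\<lambda>i. g i w)"
  by (rule additive_Sum_any[where f = "\<lambda>\<phi>. \<phi> w"])
     (simp_all add: finite_support_if_eventually_zero[OF assms])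

lemma D_subspace: "module.subspace scale_fun D"
proof -
  interpret F: vector_space scale_fun by (rule vector_space_scale_fun)
  show ?thesis
  proof (rule F.subspaceI)
    show "0 \<in> D" by (simp add: D_iff full_dual_iff)
    fix \<alpha> \<beta> assume \<alpha>: "\<alpha> \<in> D" and \<beta>: "\<beta> \<in> D"
    have "\<forall>\<^sub>F n in at_top. \<forall>w. (\<alpha> + \<beta>) (opposite_mode v n w) = 0" for v
    proof -
      have "\<forall>\<^sub>F n in at_top. \<forall>w. \<alpha> (opposite_mode v n w) = 0"
        "\<forall>\<^sub>F n in at_top. \<forall>w. \<beta> (opposite_mode v n w) = 0"
        using \<alpha> \<beta> by (auto simp: D_iff)
      then show ?thesis by eventually_elim simp
    qed
    with \<alpha> \<beta> show "\<alpha> + \<beta> \<in> D" by (auto simp: D_iff full_dual_iff algebra_simps)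
  next
    fix c \<alpha> assume \<alpha>: "\<alpha> \<in> D"
    have "\<forall>\<^sub>F n in at_top. \<forall>w. scale_fun c \<alpha> (opposite_mode v n w) = 0" for v
    proof -
      have "\<forall>\<^sub>F n in at_top. \<forall>w. \<alpha> (opposite_mode v n w) = 0"
        using \<alpha> by (auto simp: D_iff)
      then show ?thesis by eventually_elim (simp add: scale_fun_def)
    qed
    with \<alpha> show "scale_fun c \<alpha> \<in> D" by (auto simp: D_iff full_dual_iff scale_fun_def algebra_simps)
  qed
qed

theorem weak_module_D_space: "weak_module scaleV Y vac scale_fun D (dual_mode scaleV Y \<omega> YW)"
proof -
  interpret F: vector_space scale_fun by (rule vector_space_scale_fun)
  have dual: "\<alpha> \<in> full_dual scaleW" if "\<alpha> \<in> D" for \<alpha>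
    using that by (simp add: D_iff)
  have mode: "dual_mode scaleV Y \<omega> YW v n \<alpha> = (\<lambda>w. \<alpha> (opposite_mode v n w))" if "\<alpha> \<in> D" for v n \<alpha>
    by (rule dual_mode_eq[OF dual[OF that]])
  show ?thesis
  proof (intro weak_module.intro weak_module_axioms.intro)
    show "vector_space scaleV" "vector_space scale_fun" by unfold_locales
    show "F.subspace D" by (rule D_subspace)
  next
    fix \<alpha> v n assume "\<alpha> \<in> D"
    then show "dual_mode scaleV Y \<omega> YW v n \<alpha> \<in> D" by (simp add: mode D_closed)
    show "\<exists>N. \<forall>n\<ge>N. dual_mode scaleV Y \<omega> YW v n \<alpha> = 0"
      using \<open>\<alpha> \<in> D\<close> by (simp add: D_space_def)
    show "dual_mode scaleV Y \<omega> YW vac n \<alpha> = (if n = -1 then \<alpha> else 0)"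
      using \<open>\<alpha> \<in> D\<close> full_dual_zero[OF dual]
      by (auto simp: mode opposite_mode_vacuum fun_eq_iff)
  next
    fix \<alpha> u v n assume \<alpha>: "\<alpha> \<in> D"
    then show "dual_mode scaleV Y \<omega> YW (u + v) n \<alpha>
        = dual_mode scaleV Y \<omega> YW u n \<alpha> + dual_mode scaleV Y \<omega> YW v n \<alpha>"
      using dual[OF \<alpha>] by (simp add: mode opposite_mode_add_left full_dual_iff fun_eq_iff)
    fix c
    show "dual_mode scaleV Y \<omega> YW (scaleV c v) n \<alpha> = scale_fun c (dual_mode scaleV Y \<omega> YW v n \<alpha>)"
      using dual[OF \<alpha>] \<alpha>
      by (simp add: mode opposite_mode_scale_left full_dual_iff fun_eq_iff scale_fun_def)
    show "dual_mode scaleV Y \<omega> YW v n (scale_fun c \<alpha>) = scale_fun c (dual_mode scaleV Y \<omega> YW v n \<alpha>)"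
      using F.subspace_scale[OF D_subspace \<alpha>, of c] \<alpha> by (simp add: mode scale_fun_def)
    fix \<beta> assume \<beta>: "\<beta> \<in> D"
    then show "dual_mode scaleV Y \<omega> YW v n (\<alpha> + \<beta>)
        = dual_mode scaleV Y \<omega> YW v n \<alpha> + dual_mode scaleV Y \<omega> YW v n \<beta>"
      using F.subspace_add[OF D_subspace \<alpha> \<beta>] \<alpha> by (simp add: mode fun_eq_iff)
  next
    fix \<alpha> l m n u v assume \<alpha>: "\<alpha> \<in> D"
    note \<alpha>' = dual[OF \<alpha>]
    \<comment> \<open>The three families of the Jacobi identity for \<open>dual_mode\<close>,
      evaluated: transposition puts the mode applied first to \<alpha> outermost on
      \<open>W\<close>.\<close>
    define f where "f i = scale_fun ((-1) ^ i * (of_int l gchoose i))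
        (\<lambda>w. \<alpha> (opposite_mode v (n + int i) (opposite_mode u (m + l - int i) w)))" for i
    define g where "g i = scale_fun ((-1) powi l * (-1) ^ i * (of_int l gchoose i))
        (\<lambda>w. \<alpha> (opposite_mode u (m + int i) (opposite_mode v (n + l - int i) w)))" for i
    define h where "h i = scale_fun (of_int m gchoose i)
        (\<lambda>w. \<alpha> (opposite_mode (Y u (l + int i) v) (m + n - int i) w))" for i
    \<comment> \<open>In \<open>f\<close> and \<open>g\<close> the outer opposite mode has index
      growing with \<open>i\<close>, so membership of \<alpha> in \<open>D\<close> kills it for all
      \<open>w\<close> at once; for \<open>h\<close> truncation in the algebra suffices.\<close>
    have f: "\<forall>\<^sub>F i in sequentially. f i = 0"
      using D_mode_nat_shift[OF \<alpha>, of v n]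
      by eventually_elim (simp add: f_def scale_fun_def fun_eq_iff)
    have g: "\<forall>\<^sub>F i in sequentially. g i = 0"
      using D_mode_nat_shift[OF \<alpha>, of u m]
      by eventually_elim (simp add: g_def scale_fun_def fun_eq_iff)
    have h: "\<forall>\<^sub>F i in sequentially. h i = 0"
      using eventually_mode_zero[OF UNIV_I, of u l v]
      by eventually_elim (simp add: h_def scale_fun_def fun_eq_iff full_dual_zero[OF \<alpha>'])
    have smult: "c * \<alpha> x = \<alpha> (scaleW c x)" for c x
      using \<alpha>' by (simp add: full_dual_iff)
    have "Sum_any f w - Sum_any g w = Sum_any h w" for w
    proof -
      have diff: "\<alpha> (x - y) = \<alpha> x - \<alpha> y" for x y
        using \<alpha>' unfolding full_dual_iff by (metis add_diff_cancel_right' diff_add_cancel)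
      with arg_cong[OF opposite_mode_jacobi[of l v n u m w], of \<alpha>] show ?thesis
        unfolding Sum_any_fun_apply[OF f] Sum_any_fun_apply[OF g] Sum_any_fun_apply[OF h]
        by (simp only: f_def g_def h_def scale_fun_def smult diff
            full_dual_Sum_any[OF \<alpha>' finite_opposite_mode_composite]
            full_dual_Sum_any[OF \<alpha>' finite_opposite_mode_iterate])
    qed
    then have "Sum_any f - Sum_any g = Sum_any h" by (auto simp: fun_eq_iff)
    then show "Sum_any (\<lambda>i. scale_fun ((-1) ^ i * (of_int l gchoose i))
          (dual_mode scaleV Y \<omega> YW u (m + l - int i) (dual_mode scaleV Y \<omega> YW v (n + int i) \<alpha>)))
      - Sum_any (\<lambda>i. scale_fun ((-1) powi l * (-1) ^ i * (of_int l gchoose i))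
          (dual_mode scaleV Y \<omega> YW v (n + l - int i) (dual_mode scaleV Y \<omega> YW u (m + int i) \<alpha>)))
      = Sum_any (\<lambda>i. scale_fun (of_int m gchoose i)
          (dual_mode scaleV Y \<omega> YW (Y u (l + int i) v) (m + n - int i) \<alpha>))"
      using \<alpha> by (simp add: mode D_closed f_def[abs_def] g_def[abs_def] h_def[abs_def])
  qed
qed

section \<open>Comparison of \<open>D(W)\<close> with the restricted dual\<close>

lemma D_eigenspace_subset_weight_dual:
  "L0_eigenspace \<omega> scale_fun D (dual_mode scaleV Y \<omega> YW) h \<subseteq> weight_dual \<omega> scaleW YW h"
proof
  fix \<alpha> assume "\<alpha> \<in> L0_eigenspace \<omega> scale_fun D (dual_mode scaleV Y \<omega> YW) h"
  then have \<alpha>: "\<alpha> \<in> full_dual scaleW" and "dual_mode scaleV Y \<omega> YW \<omega> 1 \<alpha> = scale_fun h \<alpha>"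
    by (auto simp: L0_eigenspace_def virasoro_mode_def D_iff)
  then have eig: "\<alpha> (YW \<omega> 1 w) = h * \<alpha> w" for w
    by (simp add: dual_mode_eq opposite_mode_conformal fun_eq_iff scale_fun_def)
  have "\<alpha> w = 0" if "k \<noteq> h" "w \<in> L0_eigenspace \<omega> scaleW UNIV YW k" for k w
  proof -
    \<comment> \<open>The value of \<alpha> at \<open>L(0) w\<close>, computed in two ways.\<close>
    have "k * \<alpha> w = h * \<alpha> w"
      using that(2) eig[of w] \<alpha> by (simp add: L0_eigenspace_def virasoro_mode_def full_dual_iff)
    with that(1) show ?thesis by simp
  qed
  with \<alpha> show "\<alpha> \<in> weight_dual \<omega> scaleW YW h" by (auto simp: weight_dual_def)
qed

text \<open>For \<open>v\<close> of weight \<open>a\<close>, every term of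
  \<open>opposite_mode v n\<close> shifts the weight by \<open>n + 1 - a\<close>, whatever
  \<open>p\<close> is. So \<alpha> sees only vectors of weight \<open>h + (a - 1 - n)\<close>, and
  for large \<open>n\<close> there are none besides 0.\<close>

lemma weight_dual_subset_D:
  assumes "ordinary_module scaleV Y vac \<omega> scaleW YW"
  shows "weight_dual \<omega> scaleW YW h \<subseteq> D"
proof
  interpret O: ordinary_module scaleV Y vac \<omega> scaleW YW by fact
  fix \<alpha> assume \<alpha>: "\<alpha> \<in> weight_dual \<omega> scaleW YW h"
  then have dual: "\<alpha> \<in> full_dual scaleW"
    and vanish: "\<And>k w. k \<noteq> h \<Longrightarrow> w \<in> L0_eigenspace \<omega> scaleW UNIV YW k \<Longrightarrow> \<alpha> w = 0"
    by (auto simp: weight_dual_def)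
  obtain N where N: "\<And>n. n < N \<Longrightarrow> L0_eigenspace \<omega> scaleW UNIV YW (h + of_int n) = {0}"
    using O.weights_bounded_below by blast
  have "\<forall>\<^sub>F n in at_top. \<forall>w. \<alpha> (opposite_mode v n w) = 0" for v
  proof (induction v rule: homogeneous_induct)
    case (1 a v)
    obtain P where P: "\<And>p. p \<ge> P \<Longrightarrow> L1_div p v = 0"
      using L1_div_eventually_zero[of v] by (auto simp: eventually_sequentially)
    have opp: "opposite_mode v n w
        = scaleW ((-1) powi a) (\<Sum>p<P. YW (L1_div p v) (2 * a - 2 - n - int p) w)" for n w
      by (rule opposite_mode_homogeneous[OF 1]) (rule P)
    have sum: "\<alpha> (sum f A) = (\<Sum>x\<in>A. \<alpha> (f x))" for f :: "nat \<Rightarrow> 'w" and A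
      using dual
      by (induction A rule: infinite_finite_induct) (auto simp: full_dual_zero full_dual_iff)
    show ?case
    proof (intro eventually_at_top_linorderI allI)
      \<comment> \<open>At this threshold \<open>a - 1 - n < N\<close>, so the only weight that
        could contribute has zero eigenspace; the bound does not involve \<open>w\<close>.\<close>
      fix n w assume n: "n \<ge> a - N"
      have "w \<in> W.M.span (\<Union>k. L0_eigenspace \<omega> scaleW UNIV YW k)"
        using O.semisimple by (simp add: L0_semisimple_def)
      then show "\<alpha> (opposite_mode v n w) = 0"
      proof (induction rule: W.M.span_induct_alt)
        case base
        then show ?case by (simp add: full_dual_zero dual)
      next
        case (step c x y)
        then obtain k where x: "x \<in> L0_eigenspace \<omega> scaleW UNIV YW k" by blast
        have "\<alpha> (opposite_mode v n x) = 0"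
        proof (cases "k = h + of_int (a - 1 - n)")
          case True
          with x N[of "a - 1 - n"] n have "x = 0" by auto
          then show ?thesis by (simp add: full_dual_zero dual)
        next
          case False
          have "\<alpha> (YW (L1_div p v) (2 * a - 2 - n - int p) x) = 0" for p
            by (rule vanish[OF _ mode_weight[OF W.weak_module_axioms L1_div_weight[OF 1] x]])
               (use False in \<open>auto simp: algebra_simps\<close>)
          then show ?thesis
            using dual by (simp add: opp sum full_dual_iff)
        qed
        with step.IH dual show ?case
          by (simp add: opposite_mode_add_right opposite_mode_scale_right full_dual_iff)
      qed
    qed
  next
    case (2 u v)
    then show ?case
      by eventually_elim (use dual in \<open>simp add: opposite_mode_add_left full_dual_iff\<close>)
  qed
  with dual show "\<alpha> \<in> D" by (simp add: D_iff)
qed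

end

theorem corollary2p11:
  fixes scaleV :: "complex \<Rightarrow> 'v::ab_group_add \<Rightarrow> 'v"
    and Y :: "'v \<Rightarrow> int \<Rightarrow> 'v \<Rightarrow> 'v"
    and vac \<omega> :: 'v
  assumes "vertex_operator_algebra scaleV Y vac \<omega>"
    and "\<And>(scaleM :: complex \<Rightarrow> ('w::ab_group_add \<Rightarrow> complex) \<Rightarrow> ('w \<Rightarrow> complex)) M YM.
           weak_module scaleV Y vac scaleM M YM \<Longrightarrow> L0_semisimple \<omega> scaleM M YM"
  shows "\<forall>(scaleW :: complex \<Rightarrow> 'w \<Rightarrow> 'w) YW.
           ordinary_module scaleV Y vac \<omega> scaleW YW
             \<longrightarrow> D_space scaleV Y \<omega> scaleW YW = restricted_dual \<omega> scaleW YW"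
proof (intro allI impI)
  fix scaleW :: "complex \<Rightarrow> 'w \<Rightarrow> 'w" and YW
  assume ord: "ordinary_module scaleV Y vac \<omega> scaleW YW"
  interpret V: vertex_operator_algebra scaleV Y vac \<omega> by fact
  interpret O: ordinary_module scaleV Y vac \<omega> scaleW YW by fact
  interpret voa_weak_module scaleV Y vac \<omega> scaleW YW ..
  interpret F: vector_space scale_fun by (rule vector_space_scale_fun)
  \<comment> \<open>The semisimplicity hypothesis is used for the single weak module
    \<open>D\<close>, a subspace of the functions from \<open>W\<close> to the complex
    numbers.\<close>
  have "L0_semisimple \<omega> scale_fun D (dual_mode scaleV Y \<omega> YW)"
    by (rule assms(2)[OF weak_module_D_space])
  then have "D = F.span (\<Union>h. L0_eigenspace \<omega> scale_fun D (dual_mode scaleV Y \<omega> YW) h)"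
    by (simp add: L0_semisimple_def)
  also have "\<dots> \<subseteq> restricted_dual \<omega> scaleW YW"
    unfolding restricted_dual_def
    by (intro F.span_mono UN_mono subset_refl D_eigenspace_subset_weight_dual)
  finally have "D \<subseteq> restricted_dual \<omega> scaleW YW" .
  moreover have "restricted_dual \<omega> scaleW YW \<subseteq> D"
    unfolding restricted_dual_def
    by (intro F.span_minimal UN_least weight_dual_subset_D ord D_subspace)
  ultimately show "D_space scaleV Y \<omega> scaleW YW = restricted_dual \<omega> scaleW YW"
    by blast
qed

end
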